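(* Let $\tau:[0,1]\to[0,1]$ be a piecewise convex map with countably many branches (in the class described in the context), and let $\{\tau_n\}_{n\ge1}$ be its approximating sequence of piecewise convex maps with a finite number of branches. Fix $n\ge1$ and for $k=1,2,\dots$ let $f_{n,k}$ be a normalized fixed point of the Ulam operator $P_{\tau_n}^{(k)}$. Then the sequence $\{f_{n,k}\}_{k=1}^\infty$ is weakly pre-compact in $L^1([0,1],\lambda)$, and any (weak) limit point $f_n^*$ of the sequence $\{f_{n,k}\}_{k=1}^\infty$ is a fixed point of $P_{\tau_n}$.
   Context: $I=[0,1]$, $\lambda$ is Lebesgue measure, $L^1=L^1([0,1],\lambda)$. The map $\tau$: there are points $1=a_0>a_1>a_2>\cdots$ with $\lim_{n\to\infty}a_n=0$ such that $\tau:[0,1]\to[0,1]$ satisfies: (i) for every $j\ge 1$, $\tau|_{[a_j,a_{j-1})}$ is continuous and convex; (ii) $\tau(a_j)=0$ and $\tau'(a_j)>0$ for every $j\ge1$, where $\tau'(a_j)$ is the right derivative; (iii) $\sum_{j\ge 1}\frac{1}{\tau'(a_j)}<\infty$ (equivalently, there is $N\ge1$ with $\sum_{j\ge N+1}\frac1{\tau'(a_j)}<1$). Approximating maps: for $n\ge 1$, $\tau_n(x)=x/a_n$ for $0\le x<a_n$ and $\tau_n(x)=\tau(x)$ for $a_n\le x\le 1$. For a nonsingular measurable $T:[0,1]\to[0,1]$, the Frobenius–Perron operator $P_T:L^1\to L^1$ is defined by $\int_A P_Tf\,d\lambda=\int_{T^{-1}(A)}f\,d\lambda$ for all Lebesgue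 measurable $A$ and $f\in L^1$. Ulam operators: for $k\ge1$ let $J_1,\dots,J_k$ be the partition of $[0,1]$ into $k$ equal subintervals, $L^{(k)}\subset L^1$ the subspace of functions constant on each $J_i$ (identified with row vectors $[f_1,\dots,f_k]$, $f=\sum_i f_i\chi_{J_i}$), and $Q^{(k)}f=\sum_{i=1}^k\left(\frac1{\lambda(J_i)}\int_{J_i}f\,d\lambda\right)\chi_{J_i}$. The operator $P_{\tau_n}^{(k)}:L^{(k)}\to L^{(k)}$ is $P_{\tau_n}^{(k)}f=Q^{(k)}P_{\tau_n}f$; equivalently it sends the row vector $[f_1,\dots,f_k]$ to $[f_1,\dots,f_k]\cdot\mathbb M_n^{(k)}$ with $\mathbb M_n^{(k)}=\left(\frac{\lambda(\tau_n^{-1}(J_j)\cap J_i)}{\lambda(J_i)}\right)_{1\le i,j\le k}$. A normalized fixed point $f_{n,k}$ of $P_{\tau_n}^{(k)}$ is an invariant density: $f_{n,k}\in L^{(k)}$, $f_{n,k}\ge0$, $\int_0^1 f_{n,k}\,d\lambda=1$, $P_{\tau_n}^{(k)}f_{n,k}=f_{n,k}$. *)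

theory Defs
  imports "HOL-Analysis.Analysis"
begin

abbreviation lebI :: "real measure" where
  "lebI \<equiv> lebesgue_on {0..1}"

text \<open>Elements of \<open>L\<^sup>1\<close> are represented by integrable functions; equality in \<open>L\<^sup>1\<close>
  is equality almost everywhere.\<close>

definition L1 :: "(real \<Rightarrow> real) set" where
  "L1 = {f. integrable lebI f}"

definition L1_norm :: "(real \<Rightarrow> real) \<Rightarrow> real" where
  "L1_norm f = (LINT x|lebI. \<bar>f x\<bar>)"

text \<open>Boundedness with respect to the seminorm forces these functionals to respect equality
  almost everywhere, so they are exactly the bounded linear functionals on the quotient.\<close>

definition L1_dual :: "((real \<Rightarrow> real) \<Rightarrow> real) set" where
  "L1_dual = {\<phi>.
     (\<forall>f\<in>L1. \<forall>g\<in>L1. \<phi> (\<lambda>x. f x + g x) = \<phi> f + \<phi> g) \<and>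
     (\<forall>c. \<forall>f\<in>L1. \<phi> (\<lambda>x. c * f x) = c * \<phi> f) \<and>
     (\<exists>C. \<forall>f\<in>L1. \<bar>\<phi> f\<bar> \<le> C * L1_norm f)}"

definition weak_L1 :: "(real \<Rightarrow> real) topology" where
  "weak_L1 = topology_generated_by {{f \<in> L1. \<phi> f \<in> U} | \<phi> U. \<phi> \<in> L1_dual \<and> open U}"

definition weakly_precompact :: "(real \<Rightarrow> real) set \<Rightarrow> bool" where
  "weakly_precompact S \<longleftrightarrow> S \<subseteq> L1 \<and> compactin weak_L1 (weak_L1 closure_of S)"

text \<open>Cluster points of a sequence; limits of weakly convergent subsequences are among them.\<close>

definition weak_limit_point :: "(nat \<Rightarrow> real \<Rightarrow> real) \<Rightarrow> (real \<Rightarrow> real) \<Rightarrow> bool" where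
  "weak_limit_point s g \<longleftrightarrow>
     g \<in> L1 \<and> (\<forall>U. openin weak_L1 U \<and> g \<in> U \<longrightarrow> (\<exists>\<^sub>\<infinity>k. s k \<in> U))"

text \<open>The number \<open>d j\<close> is the right derivative of \<open>\<tau>\<close> at \<open>a j\<close>.\<close>

definition piecewise_convex_map :: "(nat \<Rightarrow> real) \<Rightarrow> (real \<Rightarrow> real) \<Rightarrow> bool" where
  "piecewise_convex_map a \<tau> \<longleftrightarrow>
     a 0 = 1 \<and> (\<forall>j. a (Suc j) < a j) \<and> a \<longlonglongrightarrow> 0 \<and>
     \<tau> \<in> {0..1} \<rightarrow> {0..1} \<and>
     (\<forall>j\<ge>1. continuous_on {a j..<a (j - 1)} \<tau> \<and> convex_on {a j..<a (j - 1)} \<tau>) \<and>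
     (\<forall>j\<ge>1. \<tau> (a j) = 0) \<and>
     (\<exists>d. (\<forall>j\<ge>1. (\<tau> has_real_derivative d j) (at_right (a j)) \<and> d j > 0) \<and>
          summable (\<lambda>j. 1 / d (Suc j)))"

definition approx_map :: "(nat \<Rightarrow> real) \<Rightarrow> (real \<Rightarrow> real) \<Rightarrow> nat \<Rightarrow> real \<Rightarrow> real" where
  "approx_map a \<tau> n x = (if x < a n then x / a n else \<tau> x)"

text \<open>For nonsingular \<open>T\<close> such an \<open>h\<close> exists by Radon--Nikodym and is unique up to
  null sets; \<open>SOME\<close> picks a representative.\<close>

definition frobenius_perron :: "(real \<Rightarrow> real) \<Rightarrow> (real \<Rightarrow> real) \<Rightarrow> real \<Rightarrow> real" where
  "frobenius_perron T f =
     (SOME h. h \<in> L1 \<and>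
        (\<forall>A\<in>sets lebI. (LINT x:A|lebI. h x) = (LINT x:(T -` A \<inter> {0..1})|lebI. f x)))"

definition fixed_point_L1 :: "((real \<Rightarrow> real) \<Rightarrow> real \<Rightarrow> real) \<Rightarrow> (real \<Rightarrow> real) \<Rightarrow> bool" where
  "fixed_point_L1 P f \<longleftrightarrow> f \<in> L1 \<and> (AE x in lebI. P f x = f x)"

text \<open>For \<open>1 \<le> i \<le> k\<close>; the last interval is closed, so that these partition \<open>{0..1}\<close>.\<close>

definition ulam_cell :: "nat \<Rightarrow> nat \<Rightarrow> real set" where
  "ulam_cell k i =
     (if i = k then {(real i - 1) / real k..1} else {(real i - 1) / real k..<real i / real k})"

definition ulam_space :: "nat \<Rightarrow> (real \<Rightarrow> real) set" where
  "ulam_space k =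
     {f \<in> L1. \<exists>c. AE x in lebI. f x = (\<Sum>i=1..k. c i * indicator (ulam_cell k i) x)}"

definition ulam_projection :: "nat \<Rightarrow> (real \<Rightarrow> real) \<Rightarrow> real \<Rightarrow> real" where
  "ulam_projection k f x =
     (\<Sum>i=1..k. (1 / measure lebI (ulam_cell k i) * (LINT y:ulam_cell k i|lebI. f y)) *
               indicator (ulam_cell k i) x)"

definition ulam_operator :: "(real \<Rightarrow> real) \<Rightarrow> nat \<Rightarrow> (real \<Rightarrow> real) \<Rightarrow> real \<Rightarrow> real" where
  "ulam_operator T k f = ulam_projection k (frobenius_perron T f)"

definition normalized_ulam_fixed_point :: "(real \<Rightarrow> real) \<Rightarrow> nat \<Rightarrow> (real \<Rightarrow> real) \<Rightarrow> bool" where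
  "normalized_ulam_fixed_point T k f \<longleftrightarrow>
     f \<in> ulam_space k \<and> (AE x in lebI. f x \<ge> 0) \<and> (LINT x|lebI. f x) = 1 \<and>
     fixed_point_L1 (ulam_operator T k) f"

end

theory Submission imports Defs begin

text \<open>
  All branches of \<open>T = \<tau>\<^sub>n\<close> are increasing and convex, so the Ulam matrix maps nonincreasing
  nonnegative vectors to nonincreasing ones. Since it also preserves mass, the least nonincreasing
  majorant and the greatest nonincreasing minorant of an invariant vector are again invariant; as the
  first branch \<open>x / a\<^sub>n\<close> expands every interval \<open>[0, s]\<close>, a nonzero nonincreasing invariant vector
  vanishes nowhere, and together these facts force every invariant density \<open>f\<^sub>n\<^sub>,\<^sub>k\<close> to be
  nonincreasing. Then \<open>f\<^sub>n\<^sub>,\<^sub>k(a\<^sub>j) \<le> 1 / a\<^sub>j\<close>, and invariance on the first cell gives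
  \<open>f\<^sub>n\<^sub>,\<^sub>k(0) \<le> a\<^sub>n f\<^sub>n\<^sub>,\<^sub>k(0) + (\<Sum>j=1..n. 1 / (a\<^sub>j \<tau>'(a\<^sub>j)))\<close>, a bound uniform in \<open>k\<close>.

  A set that is bounded in \<open>L\<^sup>\<infinity>\<close> is weakly precompact in \<open>L\<^sup>1\<close> by Banach--Alaoglu. Finally, the
  functional \<open>f \<mapsto> \<integral>\<^bsub>A\<^esub> f - \<integral>\<^bsub>T\<^sup>-\<^sup>1 A\<^esub> f\<close> is weakly continuous, vanishes at \<open>f\<^sub>n\<^sub>,\<^sub>k\<close> when \<open>A\<close> is a cell,
  and is \<open>O(1/k)\<close> when \<open>A\<close> is a half-line; so it vanishes at every weak limit point for all half-lines,
  hence for all measurable \<open>A\<close>.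
\<close>

section \<open>Stochastic matrices preserving monotone vectors\<close>

text \<open>Vectors are rows and \<open>M\<close> acts on them from the right.
  \<open>head_sum\<close> says that the image of the indicator of \<open>{1..m}\<close> is
  nonincreasing; these indicators generate the cone of nonincreasing nonnegative vectors.
  \<open>spread\<close> says that no block \<open>{1..m}\<close> with \<open>m < k\<close> is closed
  under the transitions.\<close>

locale monotone_stochastic_matrix =
  fixes k :: nat and M :: "nat \<Rightarrow> nat \<Rightarrow> real"
  assumes nonneg: "\<And>i j. i \<in> {1..k} \<Longrightarrow> j \<in> {1..k} \<Longrightarrow> 0 \<le> M i j"
    and row_sum: "\<And>i. i \<in> {1..k} \<Longrightarrow> (\<Sum>j=1..k. M i j) = 1"
    and head_sum: "\<And>m j. m \<in> {1..k} \<Longrightarrow> j \<in> {1..<k} \<Longrightarrow>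
      (\<Sum>i=1..m. M i (Suc j)) \<le> (\<Sum>i=1..m. M i j)"
    and spread: "\<And>m. m \<in> {1..<k} \<Longrightarrow> \<exists>i\<in>{1..m}. 0 < M i (Suc m)"
begin

definition act :: "(nat \<Rightarrow> real) \<Rightarrow> nat \<Rightarrow> real" where
  "act c j = (\<Sum>i=1..k. c i * M i j)"

lemma act_mono:
  assumes "\<And>i. i \<in> {1..k} \<Longrightarrow> b i \<le> c i" "j \<in> {1..k}"
  shows "act b j \<le> act c j"
  unfolding act_def by (intro sum_mono mult_right_mono assms nonneg) auto

lemma act_diff: "act (\<lambda>i. b i - c i) j = act b j - act c j"
  by (simp add: act_def left_diff_distrib sum_subtractf)

lemma sum_act: "(\<Sum>j=1..k. act c j) = (\<Sum>j=1..k. c j)"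
proof -
  have "(\<Sum>j=1..k. act c j) = (\<Sum>i=1..k. c i * (\<Sum>j=1..k. M i j))"
    unfolding act_def sum_distrib_left by (rule sum.swap)
  also have "\<dots> = (\<Sum>i=1..k. c i)"
    by (intro sum.cong) (simp_all only: row_sum mult_1_right)
  finally show ?thesis .
qed

text \<open>Abel summation writes \<open>c\<close> as a nonnegative combination of indicators of
  initial segments, and for those the claim is \<open>head_sum\<close>.\<close>

lemma act_antimono:
  assumes c: "antimono_on {1..k} c" and c0: "\<And>i. i \<in> {1..k} \<Longrightarrow> 0 \<le> c i"
  shows "antimono_on {1..k} (act c)"
proof -
  have desc: "act c (Suc j) \<le> act c j" if j: "j \<in> {1..<k}" for j
  proof -
    define D where "D = (\<lambda>i. M i j - M i (Suc j))"
    have D: "0 \<le> (\<Sum>i=1..m. D i)" if "m \<in> {1..k}" for m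
      using head_sum[OF that j] by (simp add: D_def sum_subtractf)
    \<comment> \<open>Abel summation as an induction: since the head sums of \<open>D\<close> are
      nonnegative, replacing the common factor \<open>c m\<close> by the smaller
      \<open>c (Suc m)\<close> only lowers the left-hand side.\<close>
    have "c m * (\<Sum>i=1..m. D i) \<le> (\<Sum>i=1..m. c i * D i)" if "1 \<le> m" "m \<le> k" for m
      using that
    proof (induction m rule: dec_induct)
      case base
      then show ?case by simp
    next
      case (step m)
      have "c (Suc m) * (\<Sum>i=1..Suc m. D i) \<le> c m * (\<Sum>i=1..m. D i) + c (Suc m) * D (Suc m)"
        using step.hyps step.prems D[of m] monotone_onD[OF c, of m "Suc m"]
        by (simp add: distrib_left mult_right_mono)
      with step show ?case by simp
    qed
    from this[of k] have "c k * (\<Sum>i=1..k. D i) \<le> (\<Sum>i=1..k. c i * D i)"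
      using j by auto
    moreover have "0 \<le> c k * (\<Sum>i=1..k. D i)"
      using j by (intro mult_nonneg_nonneg c0 D) auto
    ultimately show ?thesis
      by (simp add: D_def act_def right_diff_distrib sum_subtractf)
  qed
  have "act c j \<le> act c i" if "i \<le> j" "1 \<le> i" "j \<le> k" for i j
    using that
  proof (induction j rule: dec_induct)
    case (step m)
    have "act c (Suc m) \<le> act c m"
      using step.hyps step.prems by (intro desc) auto
    with step show ?case by simp
  qed simp
  then show ?thesis
    by (auto simp: monotone_on_def)
qed

text \<open>\<open>act\<close> preserves the total, so the nonnegative differences
  \<open>c j - act c j\<close> add up to zero and each of them vanishes.\<close>

lemma invariant_if_sub:
  assumes "\<And>j. j \<in> {1..k} \<Longrightarrow> act c j \<le> c j" "j \<in> {1..k}"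
  shows "act c j = c j"
proof -
  have "(\<Sum>j=1..k. c j - act c j) = 0"
    unfolding sum_subtractf sum_act by simp
  then show ?thesis
    using assms by (subst (asm) sum_nonneg_eq_0_iff) auto
qed

lemma invariant_if_super:
  assumes "\<And>j. j \<in> {1..k} \<Longrightarrow> c j \<le> act c j" "j \<in> {1..k}"
  shows "act c j = c j"
proof -
  have "(\<Sum>j=1..k. act c j - c j) = 0"
    unfolding sum_subtractf sum_act by simp
  then show ?thesis
    using assms by (subst (asm) sum_nonneg_eq_0_iff) auto
qed

text \<open>The support of a nonzero nonincreasing \<open>c\<close> is an initial block
  \<open>{1..m}\<close>. If \<open>m < k\<close>, then \<open>spread\<close> moves positive mass to
  \<open>Suc m\<close>, where an invariant \<open>c\<close> should vanish.\<close>

lemma antimono_invariant_eq_0: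
  assumes c: "antimono_on {1..k} c" and c0: "\<And>i. i \<in> {1..k} \<Longrightarrow> 0 \<le> c i"
    and inv: "\<And>j. j \<in> {1..k} \<Longrightarrow> act c j = c j" and ck: "c k = 0"
    and i: "i \<in> {1..k}"
  shows "c i = 0"
proof (rule ccontr)
  assume "c i \<noteq> 0"
  define m where "m = Max {m\<in>{1..k}. c m \<noteq> 0}"
  have "m \<in> {m\<in>{1..k}. c m \<noteq> 0}"
    unfolding m_def using i \<open>c i \<noteq> 0\<close> by (intro Max_in) auto
  then have m: "m \<in> {1..<k}" "0 < c m"
    using ck c0[of m] by (auto simp: order_less_le)
  have "c (Suc m) = 0"
  proof (rule ccontr)
    assume "c (Suc m) \<noteq> 0"
    then have "Suc m \<le> m"
      using m unfolding m_def by (intro Max_ge) auto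
    then show False by simp
  qed
  with inv[of "Suc m"] m have "(\<Sum>i=1..k. c i * M i (Suc m)) = 0"
    by (auto simp: act_def)
  then have "c i * M i (Suc m) = 0" if "i \<in> {1..k}" for i
    using that m by (subst (asm) sum_nonneg_eq_0_iff) (auto simp: c0 nonneg)
  moreover obtain i where "i \<in> {1..m}" "0 < M i (Suc m)"
    using spread m by blast
  moreover from this have "0 < c i" "i \<in> {1..k}"
    using m monotone_onD[OF c, of i m] by auto
  ultimately show False
    by (metis mult_pos_pos less_irrefl)
qed

text \<open>The maximum over the tail is the least nonincreasing majorant of \<open>c\<close>. Its
  image is nonincreasing and lies above \<open>act c = c\<close>, hence above the majorant itself;
  conservation of mass turns this into equality.\<close>

lemma majorant_invariant:
  assumes c0: "\<And>i. i \<in> {1..k} \<Longrightarrow> 0 \<le> c i"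
    and inv: "\<And>j. j \<in> {1..k} \<Longrightarrow> act c j = c j" and j: "j \<in> {1..k}"
  shows "act (\<lambda>i. Max (c ` {i..k})) j = Max (c ` {j..k})"
proof (rule invariant_if_super[OF _ j])
  let ?g = "\<lambda>i. Max (c ` {i..k})"
  fix j assume j: "j \<in> {1..k}"
  have le: "c i \<le> ?g i" if "i \<in> {1..k}" for i
    using that by (intro Max_ge) auto
  have "antimono_on {1..k} ?g"
    by (auto simp: monotone_on_def intro!: Max_mono)
  then have anti: "antimono_on {1..k} (act ?g)"
    using order_trans[OF c0 le] by (intro act_antimono) auto
  have "c i \<le> act ?g j" if "i \<in> {j..k}" for i
  proof -
    have "c i \<le> act ?g i"
      using act_mono[of c ?g i] le inv[of i] that j by auto
    also have "\<dots> \<le> act ?g j"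
      using that j by (intro monotone_onD[OF anti]) auto
    finally show ?thesis .
  qed
  then show "?g j \<le> act ?g j"
    using j by (subst Max_le_iff) auto
qed

text \<open>The dual argument: the image of the greatest nonincreasing minorant is again a
  nonincreasing minorant, so it lies below the greatest one.\<close>

lemma minorant_invariant:
  assumes c0: "\<And>i. i \<in> {1..k} \<Longrightarrow> 0 \<le> c i"
    and inv: "\<And>j. j \<in> {1..k} \<Longrightarrow> act c j = c j" and j: "j \<in> {1..k}"
  shows "act (\<lambda>i. Min (c ` {1..i})) j = Min (c ` {1..j})"
proof (rule invariant_if_sub[OF _ j])
  let ?l = "\<lambda>i. Min (c ` {1..i})"
  fix j assume j: "j \<in> {1..k}"
  have le: "?l i \<le> c i" if "i \<in> {1..k}" for i
    using that by (intro Min_le) auto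
  have "antimono_on {1..k} ?l"
    by (auto simp: monotone_on_def intro!: Min_antimono)
  then have anti: "antimono_on {1..k} (act ?l)"
    using c0 by (intro act_antimono) auto
  have "act ?l j \<le> c i" if "i \<in> {1..j}" for i
  proof -
    have "act ?l j \<le> act ?l i"
      using that j by (intro monotone_onD[OF anti]) auto
    also have "\<dots> \<le> c i"
      using act_mono[of ?l c i] le inv[of i] that j by auto
    finally show ?thesis .
  qed
  then show "act ?l j \<le> ?l j"
    using j by (subst Min_ge_iff) auto
qed

text \<open>The gap \<open>w\<close> between the least nonincreasing majorant and \<open>c\<close>
  is invariant and vanishes at \<open>k\<close>. Its nonincreasing minorant is then invariant and
  vanishes at \<open>k\<close>, so it is zero; its first entry is \<open>w 1\<close>, and
  \<open>w 1 = 0\<close> says that \<open>c 1\<close> is the maximum.\<close>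

lemma invariant_le_first:
  assumes c0: "\<And>i. i \<in> {1..k} \<Longrightarrow> 0 \<le> c i"
    and inv: "\<And>j. j \<in> {1..k} \<Longrightarrow> act c j = c j" and i: "i \<in> {1..k}"
  shows "c i \<le> c 1"
proof -
  define w where "w = (\<lambda>i. Max (c ` {i..k}) - c i)"
  have w0: "0 \<le> w i" if "i \<in> {1..k}" for i
    using that by (auto simp: w_def intro!: Max_ge)
  have w_inv: "act w j = w j" if "j \<in> {1..k}" for j
    using majorant_invariant[OF c0 inv that] inv[OF that] by (simp add: w_def act_diff)
  let ?l = "\<lambda>i. Min (w ` {1..i})"
  have "?l 1 = 0"
  proof (rule antimono_invariant_eq_0[where c = ?l])
    show "antimono_on {1..k} ?l"
      by (auto simp: monotone_on_def intro!: Min_antimono)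
    show "act ?l j = ?l j" if "j \<in> {1..k}" for j
      by (rule minorant_invariant[OF w0 w_inv that])
    show "0 \<le> ?l i" if "i \<in> {1..k}" for i
      using that w0 by auto
    have "?l k \<le> w k" "0 \<le> ?l k"
      using i w0 by (auto intro!: Min_le)
    then show "?l k = 0"
      by (simp add: w_def)
    show "1 \<in> {1..k}"
      using i by auto
  qed
  then have "Max (c ` {1..k}) = c 1"
    by (simp add: w_def)
  moreover have "c i \<le> Max (c ` {1..k})"
    using i by (intro Max_ge) auto
  ultimately show ?thesis
    by simp
qed

text \<open>The excess \<open>u\<close> of \<open>c\<close> over its greatest nonincreasing minorant
  is a nonnegative invariant vector, hence bounded by its first entry, which is zero. So
  \<open>c\<close> equals the minorant.\<close>

lemma invariant_antimono:
  assumes c0: "\<And>i. i \<in> {1..k} \<Longrightarrow> 0 \<le> c i"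
    and inv: "\<And>j. j \<in> {1..k} \<Longrightarrow> act c j = c j"
  shows "antimono_on {1..k} c"
proof -
  define u where "u = (\<lambda>i. c i - Min (c ` {1..i}))"
  have u0: "0 \<le> u i" if "i \<in> {1..k}" for i
    using that by (auto simp: u_def intro!: Min_le)
  have u_inv: "act u j = u j" if "j \<in> {1..k}" for j
    using minorant_invariant[OF c0 inv that] inv[OF that] by (simp add: u_def act_diff)
  have "u i = 0" if "i \<in> {1..k}" for i
    using invariant_le_first[OF u0 u_inv that] u0[OF that] by (auto simp: u_def)
  then have eq: "Min (c ` {1..i}) = c i" if "i \<in> {1..k}" for i
    using that by (simp add: u_def)
  have "c j \<le> c i" if "i \<in> {1..k}" "j \<in> {1..k}" "i \<le> j" for i j
    unfolding eq[OF that(1), symmetric] eq[OF that(2), symmetric]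
    using that by (intro Min_antimono) auto
  then show ?thesis
    by (auto simp: monotone_on_def)
qed

end

section \<open>The dual of \<open>L\<^sup>1\<close>\<close>

lemma (in finite_measure) Radon_Nikodym_integrable:
  assumes N: "finite_measure N" "absolutely_continuous M N" "sets N = sets M"
  obtains h :: "'a \<Rightarrow> real" where "integrable M h" "\<And>x. 0 \<le> h x"
    "\<And>A. A \<in> sets M \<Longrightarrow> measure N A = (LINT x:A|M. h x)"
proof -
  obtain h where [measurable]: "h \<in> borel_measurable M"
    and h: "AE x in M. RN_deriv M N x = ennreal (h x)" and h0: "\<And>x. 0 \<le> h x"
    using real_RN_deriv[OF N] by metis
  interpret N: finite_measure N by fact
  have N_eq: "emeasure N A = (\<integral>\<^sup>+x. ennreal (indicator A x * h x) \<partial>M)" if [measurable]: "A \<in> sets M" for A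
  proof -
    have "emeasure N A = emeasure (density M (RN_deriv M N)) A"
      using N by (simp add: density_RN_deriv)
    also have "\<dots> = (\<integral>\<^sup>+x. RN_deriv M N x * indicator A x \<partial>M)"
      by (simp add: emeasure_density)
    also have "\<dots> = (\<integral>\<^sup>+x. ennreal (indicator A x * h x) \<partial>M)"
      using h by (intro nn_integral_cong_AE) (auto split: split_indicator)
    finally show ?thesis .
  qed
  have int: "integrable M (\<lambda>x. indicator A x * h x)" if [measurable]: "A \<in> sets M" for A
    using h0 N_eq[OF that] N.emeasure_finite[of A]
    by (intro integrableI_nonneg) (auto simp: less_top[symmetric])
  show ?thesis
  proof
    show "integrable M h"
      using int[OF sets.top] by (rule Bochner_Integration.integrable_cong[THEN iffD1, rotated 2]) auto
    show "measure N A = (LINT x:A|M. h x)" if "A \<in> sets M" for A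
      using N_eq[OF that] int[OF that] h0
      by (simp add: measure_def set_lebesgue_integral_def integral_eq_nn_integral)
  qed (fact h0)
qed

text \<open>Domination by a multiple of \<open>M\<close> gives continuity at the empty set, which
  upgrades finite to countable additivity, and it also gives absolute continuity.\<close>

lemma (in finite_measure) Radon_Nikodym_set_function:
  fixes \<nu> :: "'a set \<Rightarrow> real"
  assumes add: "\<And>A B. A \<in> sets M \<Longrightarrow> B \<in> sets M \<Longrightarrow> A \<inter> B = {} \<Longrightarrow> \<nu> (A \<union> B) = \<nu> A + \<nu> B"
    and nonneg: "\<And>A. A \<in> sets M \<Longrightarrow> 0 \<le> \<nu> A"
    and le: "\<And>A. A \<in> sets M \<Longrightarrow> \<nu> A \<le> C * measure M A"
  obtains h :: "'a \<Rightarrow> real" where "integrable M h"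
    "\<And>A. A \<in> sets M \<Longrightarrow> \<nu> A = (LINT x:A|M. h x)"
proof -
  define N where "N = measure_of (space M) (sets M) (\<lambda>A. ennreal (\<nu> A))"
  have emp: "\<nu> {} = 0"
    using add[of "{}" "{}"] by simp
  have N_sets [simp]: "sets N = sets M" "space N = space M"
    by (simp_all add: N_def)
  have "countably_additive (sets M) (\<lambda>A. ennreal (\<nu> A))"
  proof (rule sets.empty_continuous_imp_countably_additive)
    show "positive (sets M) (\<lambda>A. ennreal (\<nu> A))"
      by (simp add: positive_def emp)
    show "Measure_Space.additive (sets M) (\<lambda>A. ennreal (\<nu> A))"
      by (auto simp: Measure_Space.additive_def add nonneg)
    fix A :: "nat \<Rightarrow> 'a set"
    assume A: "range A \<subseteq> sets M" "decseq A" "(\<Inter>i. A i) = {}"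
    have "(\<lambda>i. C * measure M (A i)) \<longlonglongrightarrow> C * measure M (\<Inter>i. A i)"
      by (intro tendsto_intros finite_Lim_measure_decseq A)
    then have "(\<lambda>i. C * measure M (A i)) \<longlonglongrightarrow> 0"
      by (simp add: A)
    moreover have "\<forall>i. norm (\<nu> (A i)) \<le> C * measure M (A i)"
      using A nonneg le by (simp add: range_subsetD)
    ultimately have "(\<lambda>i. \<nu> (A i)) \<longlonglongrightarrow> 0"
      by (rule Lim_null_comparison[OF always_eventually, rotated])
    from tendsto_ennrealI[OF this] show "(\<lambda>i. ennreal (\<nu> (A i))) \<longlonglongrightarrow> 0"
      by simp
  qed simp
  then have N_eq: "emeasure N A = ennreal (\<nu> A)" if "A \<in> sets M" for A
    using that unfolding N_def
    by (intro emeasure_measure_of_sigma) (auto simp: positive_def emp sets.sigma_algebra_axioms)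
  have "finite_measure N"
    by (rule finite_measureI) (simp add: N_eq)
  moreover have "absolutely_continuous M N"
    unfolding absolutely_continuous_def
  proof
    fix A assume A: "A \<in> null_sets M"
    then have "\<nu> A \<le> 0"
      using le[of A] by (simp add: measure_eq_0_null_sets null_setsD2)
    with A show "A \<in> null_sets N"
      by (auto simp: null_sets_def N_eq ennreal_eq_0_iff)
  qed
  ultimately obtain h :: "'a \<Rightarrow> real" where h: "integrable M h"
    "\<And>A. A \<in> sets M \<Longrightarrow> measure N A = (LINT x:A|M. h x)"
    by (rule Radon_Nikodym_integrable) simp_all
  show ?thesis
  proof (rule that[OF h(1)])
    show "\<nu> A = (LINT x:A|M. h x)" if "A \<in> sets M" for A
      using h(2)[OF that] that by (simp add: measure_def N_eq nonneg)
  qed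
qed

section \<open>Integrable functions on the unit interval and bounded functionals\<close>

lemma finite_measure_lebI: "finite_measure lebI"
  by (simp add: finite_measure_lebesgue_on)

interpretation lebI: finite_measure lebI
  by (rule finite_measure_lebI)

lemma L1_add: "f \<in> L1 \<Longrightarrow> g \<in> L1 \<Longrightarrow> (\<lambda>x. f x + g x) \<in> L1"
  and L1_scale: "f \<in> L1 \<Longrightarrow> (\<lambda>x. c * f x) \<in> L1"
  and L1_diff: "f \<in> L1 \<Longrightarrow> g \<in> L1 \<Longrightarrow> (\<lambda>x. f x - g x) \<in> L1"
  and L1_indicator: "A \<in> sets lebI \<Longrightarrow> indicator A \<in> L1"
  by (auto simp: L1_def lebI.emeasure_finite[unfolded less_top] less_top[symmetric])

lemma L1_dual_add: "\<phi> \<in> L1_dual \<Longrightarrow> f \<in> L1 \<Longrightarrow> g \<in> L1 \<Longrightarrow> \<phi> (\<lambda>x. f x + g x) = \<phi> f + \<phi> g"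
  and L1_dual_scale: "\<phi> \<in> L1_dual \<Longrightarrow> f \<in> L1 \<Longrightarrow> \<phi> (\<lambda>x. c * f x) = c * \<phi> f"
  by (simp_all add: L1_dual_def)

lemma L1_dual_diff:
  assumes "\<phi> \<in> L1_dual" "f \<in> L1" "g \<in> L1"
  shows "\<phi> (\<lambda>x. f x - g x) = \<phi> f - \<phi> g"
proof -
  have "\<phi> (\<lambda>x. f x + (-1) * g x) = \<phi> f + (-1) * \<phi> g"
    using L1_dual_add[OF assms(1,2) L1_scale[OF assms(3)]] L1_dual_scale[OF assms(1,3)] by metis
  then show ?thesis by simp
qed

lemma L1_dual_cong_AE:
  assumes \<phi>: "\<phi> \<in> L1_dual" and f: "f \<in> L1" and g: "g \<in> L1" and eq: "AE x in lebI. f x = g x"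
  shows "\<phi> f = \<phi> g"
proof -
  obtain C where "\<forall>u\<in>L1. \<bar>\<phi> u\<bar> \<le> C * L1_norm u"
    using \<phi> unfolding L1_dual_def by blast
  then have "\<bar>\<phi> (\<lambda>x. f x - g x)\<bar> \<le> C * L1_norm (\<lambda>x. f x - g x)"
    using L1_diff[OF f g] by blast
  also have "L1_norm (\<lambda>x. f x - g x) = 0"
    unfolding L1_norm_def by (rule integral_eq_zero_AE) (use eq in auto)
  finally show ?thesis
    by (simp add: L1_dual_diff[OF \<phi> f g])
qed

lemma integrable_mult_bounded:
  fixes f h :: "'a \<Rightarrow> real"
  assumes f: "integrable M f" and [measurable]: "h \<in> borel_measurable M"
    and h: "AE x in M. \<bar>h x\<bar> \<le> C"
  shows "integrable M (\<lambda>x. h x * f x)"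
proof (rule Bochner_Integration.integrable_bound[where f = "\<lambda>x. C * f x"])
  show "AE x in M. norm (h x * f x) \<le> norm (C * f x)"
    using h by eventually_elim (auto simp: abs_mult intro!: mult_right_mono)
qed (use f in auto)

lemma abs_LINT_mult_le:
  assumes f: "f \<in> L1" and [measurable]: "h \<in> borel_measurable lebI"
    and h: "AE x in lebI. \<bar>h x\<bar> \<le> C"
  shows "\<bar>LINT x|lebI. h x * f x\<bar> \<le> C * L1_norm f"
proof -
  have int: "integrable lebI f"
    using f by (simp add: L1_def)
  have "\<bar>LINT x|lebI. h x * f x\<bar> \<le> (LINT x|lebI. \<bar>h x * f x\<bar>)"
    by (rule integral_abs_bound)
  also have "\<dots> \<le> (LINT x|lebI. C * \<bar>f x\<bar>)"
  proof (rule integral_mono_AE)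
    show "AE x in lebI. \<bar>h x * f x\<bar> \<le> C * \<bar>f x\<bar>"
      using h by eventually_elim (auto simp: abs_mult intro!: mult_right_mono)
  qed (use int integrable_mult_bounded[OF int _ h] in auto)
  finally show ?thesis
    by (simp add: L1_norm_def)
qed

lemma LINT_mult_in_L1_dual:
  assumes [measurable]: "h \<in> borel_measurable lebI" and h: "AE x in lebI. \<bar>h x\<bar> \<le> C"
  shows "(\<lambda>f. LINT x|lebI. h x * f x) \<in> L1_dual"
  using abs_LINT_mult_le[OF _ assms] integrable_mult_bounded[OF _ assms]
  by (auto simp: L1_dual_def L1_def distrib_left mult.left_commute[of "h _"])

lemma set_LINT_in_L1_dual:
  assumes "A \<in> sets lebI"
  shows "(\<lambda>f. LINT x:A|lebI. f x) \<in> L1_dual"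
  unfolding set_lebesgue_integral_def real_scaleR_def
  by (rule LINT_mult_in_L1_dual[where C = 1]) (use assms in auto)

lemma set_integrable_lebI: "integrable lebI f \<Longrightarrow> A \<in> sets lebI \<Longrightarrow> set_integrable lebI A f"
  for f :: "real \<Rightarrow> real"
  unfolding set_integrable_def by (rule integrable_mult_indicator)

lemma set_LINT_diff_const:
  assumes "integrable lebI h" "A \<in> sets lebI"
  shows "(LINT x:A|lebI. h x - c) = (LINT x:A|lebI. h x) - c * measure lebI A"
proof -
  have "(LINT x:A|lebI. h x - c) = (LINT x:A|lebI. h x) - (LINT x:A|lebI. c)"
    using assms by (intro set_integral_diff set_integrable_lebI) auto
  also have "(LINT x:A|lebI. c) = c * measure lebI A"
    using assms by (simp add: set_integral_const lebI.emeasure_finite)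
  finally show ?thesis .
qed

lemma AE_le_if_set_LINT_le:
  assumes "integrable lebI h"
    and "\<And>A. A \<in> sets lebI \<Longrightarrow> (LINT x:A|lebI. h x) \<le> C * measure lebI A"
  shows "AE x in lebI. h x \<le> C"
proof -
  have "AE x in lebI. 0 \<le> - (h x - C)"
  proof (rule lebI.density_nonneg)
    fix A assume A: "A \<in> sets lebI"
    have "(LINT x:A|lebI. - (h x - C)) = - (LINT x:A|lebI. h x - C)"
      by (simp only: set_lebesgue_integral_def scaleR_minus_right integral_minus)
    then show "0 \<le> (LINT x:A|lebI. - (h x - C))"
      using assms(2)[OF A] set_LINT_diff_const[OF assms(1) A, of C] by simp
  qed (use assms in auto)
  then show ?thesis by auto
qed

text \<open>The hypotheses are those of the limit case of \<open>integrable_induct\<close>, whence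
  the factor 2; the difference is then dominated by three times the modulus of
  \<open>f\<close>.\<close>

lemma tendsto_L1_norm_dominated:
  fixes s :: "nat \<Rightarrow> real \<Rightarrow> real"
  assumes s: "\<And>i. integrable lebI (s i)" and f: "integrable lebI f"
    and lim: "\<And>x. x \<in> space lebI \<Longrightarrow> (\<lambda>i. s i x) \<longlonglongrightarrow> f x"
    and le: "\<And>i x. x \<in> space lebI \<Longrightarrow> norm (s i x) \<le> 2 * norm (f x)"
  shows "(\<lambda>i. L1_norm (\<lambda>x. s i x - f x)) \<longlonglongrightarrow> 0"
proof -
  have "(\<lambda>i. LINT x|lebI. \<bar>s i x - f x\<bar>) \<longlonglongrightarrow> (LINT x|lebI. 0)"
  proof (rule integral_dominated_convergence[where w = "\<lambda>x. 3 * norm (f x)"])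
    show "AE x in lebI. (\<lambda>i. \<bar>s i x - f x\<bar>) \<longlonglongrightarrow> 0"
      using lim by (intro AE_I2) (metis LIM_zero tendsto_rabs_zero)
    show "AE x in lebI. norm \<bar>s i x - f x\<bar> \<le> 3 * norm (f x)" for i
      using le[of _ i] by (intro AE_I2) (smt (verit) real_norm_def)
  qed (use s f in auto)
  then show ?thesis
    by (simp add: L1_norm_def)
qed

lemma L1_dual_tendsto:
  assumes \<phi>: "\<phi> \<in> L1_dual" and s: "\<And>i. s i \<in> L1" and f: "f \<in> L1"
    and lim: "(\<lambda>i. L1_norm (\<lambda>x. s i x - f x)) \<longlonglongrightarrow> 0"
  shows "(\<lambda>i. \<phi> (s i)) \<longlonglongrightarrow> \<phi> f"
proof -
  obtain C where C: "\<forall>u\<in>L1. \<bar>\<phi> u\<bar> \<le> C * L1_norm u"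
    using \<phi> unfolding L1_dual_def by blast
  have "(\<lambda>i. C * L1_norm (\<lambda>x. s i x - f x)) \<longlonglongrightarrow> C * 0"
    by (intro tendsto_intros lim)
  then have lim0: "(\<lambda>i. C * L1_norm (\<lambda>x. s i x - f x)) \<longlonglongrightarrow> 0"
    by simp
  have "norm (\<phi> (s i) - \<phi> f) \<le> C * L1_norm (\<lambda>x. s i x - f x)" for i
    unfolding real_norm_def L1_dual_diff[OF \<phi> s f, symmetric] using C L1_diff[OF s f] by blast
  then have "(\<lambda>i. \<phi> (s i) - \<phi> f) \<longlonglongrightarrow> 0"
    using lim0 by (intro Lim_null_comparison[OF _ lim0] always_eventually) auto
  then show ?thesis
    by (rule LIM_zero_cancel)
qed

text \<open>Adding a multiple of the integral makes a bounded functional positive, so that its values on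
  indicators form a measure dominated by a multiple of Lebesgue measure.\<close>

lemma L1_dual_representation:
  assumes \<phi>: "\<phi> \<in> L1_dual" and bound: "\<And>f. f \<in> L1 \<Longrightarrow> \<bar>\<phi> f\<bar> \<le> C * L1_norm f"
  obtains h where "h \<in> L1" "AE x in lebI. \<bar>h x\<bar> \<le> C" "\<And>f. f \<in> L1 \<Longrightarrow> \<phi> f = (LINT x|lebI. h x * f x)"
proof -
  have ind: "\<bar>\<phi> (indicator A)\<bar> \<le> C * measure lebI A" if "A \<in> sets lebI" for A
    using bound[OF L1_indicator[OF that]] sets.sets_into_space[OF that]
    by (simp add: L1_norm_def Int_absorb2)
  \<comment> \<open>On an indicator \<phi> lies between \<open>-C\<close> and \<open>C\<close> times
    the measure of the set, so \<nu> lies between 0 and \<open>2 * C\<close> times it.\<close>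
  define \<nu> where "\<nu> A = \<phi> (indicator A) + C * measure lebI A" for A
  obtain h where h: "integrable lebI h" and \<nu>: "\<And>A. A \<in> sets lebI \<Longrightarrow> \<nu> A = (LINT x:A|lebI. h x)"
  proof (rule lebI.Radon_Nikodym_set_function[of \<nu> "2 * C"])
    fix A B assume A: "A \<in> sets lebI" and B: "B \<in> sets lebI" and "A \<inter> B = {}"
    then have "indicator (A \<union> B) = (\<lambda>x. indicator A x + indicator B x :: real)"
      by (auto simp: indicator_def fun_eq_iff)
    then show "\<nu> (A \<union> B) = \<nu> A + \<nu> B"
      using L1_dual_add[OF \<phi> L1_indicator[OF A] L1_indicator[OF B]] lebI.finite_measure_Union[OF A B \<open>A \<inter> B = {}\<close>]
      by (simp add: \<nu>_def distrib_left)
  next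
    fix A assume "A \<in> sets lebI"
    from ind[OF this] show "0 \<le> \<nu> A" "\<nu> A \<le> 2 * C * measure lebI A"
      by (auto simp: \<nu>_def)
  qed blast
  \<comment> \<open>Subtracting the constant undoes the shift by \<open>C\<close>, so integrals of
    \<open>g\<close> over sets give \<phi> itself on indicators.\<close>
  define g where "g x = h x - C" for x
  have g: "integrable lebI g"
    unfolding g_def using h by auto
  have g_ind: "(LINT x:A|lebI. g x) = \<phi> (indicator A)" if A: "A \<in> sets lebI" for A
    using set_LINT_diff_const[OF h A, of C] \<nu>[OF A] by (simp add: \<nu>_def g_def)
  have "AE x in lebI. g x \<le> C"
    by (rule AE_le_if_set_LINT_le[OF g]) (use g_ind ind in fastforce)
  moreover have "AE x in lebI. - g x \<le> C"
  proof (rule AE_le_if_set_LINT_le)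
    fix A assume A: "A \<in> sets lebI"
    show "(LINT x:A|lebI. - g x) \<le> C * measure lebI A"
      using g_ind[OF A] ind[OF A] by (simp add: set_lebesgue_integral_def)
  qed (use g in auto)
  ultimately have g_le: "AE x in lebI. \<bar>g x\<bar> \<le> C"
    by eventually_elim auto
  have [measurable]: "g \<in> borel_measurable lebI"
    using g by auto
  have g_dual: "(\<lambda>f. LINT x|lebI. g x * f x) \<in> L1_dual"
    using g_le by (intro LINT_mult_in_L1_dual) auto
  \<comment> \<open>Both sides are linear and continuous for the seminorm and agree on indicators,
    so the identity extends to all integrable functions.\<close>
  have "\<phi> f = (LINT x|lebI. g x * f x)" if "integrable lebI f" for f
    using that
  proof (induction f rule: integrable_induct)
    case (base A c)
    have "\<phi> (\<lambda>x. c * indicator A x) = c * (LINT x:A|lebI. g x)"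
      using base by (simp add: L1_dual_scale[OF \<phi>] L1_indicator g_ind)
    then show ?case
      by (simp add: set_lebesgue_integral_def mult_ac)
  next
    case (add f f')
    then show ?case
      using L1_dual_add[OF \<phi>, of f f']
      by (simp add: L1_def distrib_left integrable_mult_bounded[OF _ _ g_le])
  next
    case (lim f s)
    then have L1: "f \<in> L1" "s i \<in> L1" for i
      by (auto simp: L1_def)
    have *: "(\<lambda>i. L1_norm (\<lambda>x. s i x - f x)) \<longlonglongrightarrow> 0"
      using lim by (intro tendsto_L1_norm_dominated) auto
    have "(\<lambda>i. \<phi> (s i)) \<longlonglongrightarrow> \<phi> f"
      using L1 by (intro L1_dual_tendsto[OF \<phi> _ _ *])
    moreover have "(\<lambda>i. \<phi> (s i)) \<longlonglongrightarrow> (LINT x|lebI. g x * f x)"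
      using L1_dual_tendsto[OF g_dual L1(2) L1(1) *] lim by simp
    ultimately show ?case
      by (rule LIMSEQ_unique)
  qed
  with g g_le that show ?thesis
    by (auto simp: L1_def)
qed

section \<open>Weak compactness of bounded sets\<close>

lemma openin_weak_L1_basis:
  "\<phi> \<in> L1_dual \<Longrightarrow> open U \<Longrightarrow> openin weak_L1 {f \<in> L1. \<phi> f \<in> U}"
  unfolding weak_L1_def by (rule topology_generated_by_Basis) auto

lemma topspace_weak_L1: "topspace weak_L1 = L1"
proof
  show "L1 \<subseteq> topspace weak_L1"
    using openin_subset[OF openin_weak_L1_basis[OF set_LINT_in_L1_dual[of "{}"] open_UNIV]] by auto
qed (auto simp: weak_L1_def)

text \<open>Functionals in the dual do not distinguish functions that agree almost everywhere, and
  this passes through finite intersections and unions. It allows a point to be replaced by another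
  representative in covering arguments.\<close>

lemma openin_weak_L1_cong_AE:
  assumes U: "openin weak_L1 U" and f: "f \<in> U" and g: "g \<in> L1" and eq: "AE x in lebI. f x = g x"
  shows "g \<in> U"
proof -
  have "generate_topology_on {{f \<in> L1. \<phi> f \<in> U} | \<phi> U. \<phi> \<in> L1_dual \<and> open U} U"
    using U unfolding weak_L1_def by (rule openin_topology_generated_by)
  then show ?thesis
    using f
  proof (induction rule: generate_topology_on.induct)
    case (Basis s)
    then obtain \<phi> U where "\<phi> \<in> L1_dual" "f \<in> L1" "\<phi> f \<in> U" "s = {f \<in> L1. \<phi> f \<in> U}"
      by auto
    moreover from this have "\<phi> g = \<phi> f"
      by (metis L1_dual_cong_AE g eq)
    ultimately show ?case
      using g by simp
  qed auto
qed

text \<open>A violation of either bound is detected by the integral over some measurable set, which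
  is a weakly open condition; the complement is the union of these conditions.\<close>

lemma closedin_weak_L1_order_interval:
  "closedin weak_L1 {g \<in> L1. AE x in lebI. 0 \<le> g x \<and> g x \<le> C}"
proof -
  let ?I = "\<lambda>A g. LINT x:A|lebI. g x"
  let ?lo = "\<lambda>A. {g \<in> L1. ?I A g \<in> {..<0}}"
  let ?hi = "\<lambda>A. {g \<in> L1. ?I A g \<in> {C * measure lebI A<..}}"
  have "L1 - {g \<in> L1. AE x in lebI. 0 \<le> g x \<and> g x \<le> C} = (\<Union>A\<in>sets lebI. ?lo A \<union> ?hi A)" (is "?l = ?r")
  proof (intro set_eqI iffI)
    fix g assume g: "g \<in> ?r"
    then obtain A where A: "A \<in> sets lebI" and gA: "g \<in> L1" "?I A g < 0 \<or> C * measure lebI A < ?I A g"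
      by auto
    have "\<not> (AE x in lebI. 0 \<le> g x \<and> g x \<le> C)"
    proof
      assume ae: "AE x in lebI. 0 \<le> g x \<and> g x \<le> C"
      have "0 \<le> ?I A g"
        unfolding set_lebesgue_integral_def
        by (rule integral_nonneg_AE) (use ae in eventually_elim, auto)
      moreover have "?I A g \<le> (LINT x:A|lebI. C)"
        using gA(1) A ae
        by (intro set_integral_mono_AE set_integrable_lebI) (auto simp: L1_def)
      moreover have "(LINT x:A|lebI. C) = C * measure lebI A"
        using A by (simp add: set_integral_const lebI.emeasure_finite)
      ultimately show False
        using gA(2) by simp
    qed
    then show "g \<in> ?l"
      using gA by auto
  next
    fix g assume "g \<in> ?l"
    then have g: "integrable lebI g" "\<not> (AE x in lebI. 0 \<le> g x \<and> g x \<le> C)"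
      by (auto simp: L1_def)
    show "g \<in> ?r"
    proof (rule ccontr)
      assume n: "g \<notin> ?r"
      have "AE x in lebI. 0 \<le> g x"
        using n g(1) by (intro lebI.density_nonneg) (auto simp: L1_def not_less)
      moreover have "AE x in lebI. g x \<le> C"
        using n g(1) by (intro AE_le_if_set_LINT_le) (auto simp: L1_def not_less)
      ultimately show False
        using g(2) by auto
    qed
  qed
  moreover have "openin weak_L1 (\<Union>A\<in>sets lebI. ?lo A \<union> ?hi A)"
  proof (rule openin_Union)
    fix V assume "V \<in> (\<lambda>A. ?lo A \<union> ?hi A) ` sets lebI"
    then obtain A where "A \<in> sets lebI" "V = ?lo A \<union> ?hi A"
      by blast
    then show "openin weak_L1 V"
      by (simp only:) (intro openin_Un openin_weak_L1_basis set_LINT_in_L1_dual open_lessThan open_greaterThan)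
  qed
  ultimately show ?thesis
    by (auto simp: closedin_def topspace_weak_L1)
qed

text \<open>Banach--Alaoglu: by the representation of the dual, the ball of radius \<open>C\<close> in \<open>L\<^sup>\<infinity>\<close> is the
  image of a ball of functionals on \<open>L\<^sup>1\<close>, which is compact for pointwise convergence; the map is
  continuous into the weak topology because every weak functional is itself integration
  against some element of \<open>L\<^sup>\<infinity> \<subseteq> L\<^sup>1\<close>.\<close>

lemma compactin_weak_L1_ball: "compactin weak_L1 {g \<in> L1. AE x in lebI. \<bar>g x\<bar> \<le> C}"
proof -
  define K where "K = {g \<in> L1. AE x in lebI. \<bar>g x\<bar> \<le> C}"
  \<comment> \<open>Functionals are made zero outside \<open>L1\<close>, so that every coordinate is
    confined to a compact interval. Each clause constrains only finitely many coordinates at a time,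
    so \<open>Z\<close> is closed for pointwise convergence.\<close>
  define Z :: "((real \<Rightarrow> real) \<Rightarrow> real) set" where "Z = {\<Lambda>.
    (\<forall>f g. f \<in> L1 \<longrightarrow> g \<in> L1 \<longrightarrow> \<Lambda> (\<lambda>x. f x + g x) = \<Lambda> f + \<Lambda> g) \<and>
    (\<forall>c f. f \<in> L1 \<longrightarrow> \<Lambda> (\<lambda>x. c * f x) = c * \<Lambda> f) \<and>
    (\<forall>f. f \<in> L1 \<longrightarrow> \<bar>\<Lambda> f\<bar> \<le> C * L1_norm f) \<and>
    (\<forall>f. f \<notin> L1 \<longrightarrow> \<Lambda> f = 0)}"
  have Z_dual: "\<Lambda> \<in> L1_dual" if "\<Lambda> \<in> Z" for \<Lambda>
    using that by (auto simp: Z_def L1_dual_def)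
  have "closed Z"
    unfolding Z_def
    by (intro closed_Collect_conj closed_Collect_all closed_Collect_imp open_Collect_const
        closed_Collect_eq closed_Collect_le continuous_intros continuous_on_product_coordinates)
  define R where "R f = (if f \<in> L1 then C * L1_norm f else 0)" for f
  have "compactin (product_topology (\<lambda>_. euclidean) UNIV) (PiE UNIV (\<lambda>f. {- R f..R f}))"
    by (subst compactin_PiE) auto
  then have "compact (PiE UNIV (\<lambda>f. {- R f..R f}))"
    by (simp add: euclidean_product_topology)
  then have "compact (PiE UNIV (\<lambda>f. {- R f..R f}) \<inter> Z)"
    using \<open>closed Z\<close> by (rule compact_Int_closed)
  also have "PiE UNIV (\<lambda>f. {- R f..R f}) \<inter> Z = Z"
    by (auto simp: Z_def R_def abs_le_iff)
  finally have "compact Z" .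
  have "\<exists>h. h \<in> K \<and> (\<forall>f\<in>L1. \<Lambda> f = (LINT x|lebI. h x * f x))" if \<Lambda>: "\<Lambda> \<in> Z" for \<Lambda>
  proof -
    have "\<bar>\<Lambda> f\<bar> \<le> C * L1_norm f" if "f \<in> L1" for f
      using that \<Lambda> by (simp add: Z_def)
    then obtain h where "h \<in> L1" "AE x in lebI. \<bar>h x\<bar> \<le> C" "\<And>f. f \<in> L1 \<Longrightarrow> \<Lambda> f = (LINT x|lebI. h x * f x)"
      by (rule L1_dual_representation[OF Z_dual[OF \<Lambda>]]) blast+
    then show ?thesis
      by (auto simp: K_def)
  qed
  then obtain D where D: "\<And>\<Lambda>. \<Lambda> \<in> Z \<Longrightarrow> D \<Lambda> \<in> K"
    "\<And>\<Lambda> f. \<Lambda> \<in> Z \<Longrightarrow> f \<in> L1 \<Longrightarrow> \<Lambda> f = (LINT x|lebI. D \<Lambda> x * f x)"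
    by metis
  have "continuous_map (top_of_set Z) weak_L1 D"
    unfolding weak_L1_def continuous_on_generated_topo_iff
  proof (intro conjI allI impI)
    fix V assume "V \<in> {{f \<in> L1. \<phi> f \<in> U} | \<phi> U. \<phi> \<in> L1_dual \<and> open U}"
    then obtain \<phi> U where \<phi>: "\<phi> \<in> L1_dual" and "open U" and V: "V = {f \<in> L1. \<phi> f \<in> U}"
      by auto
    obtain B where "\<And>f. f \<in> L1 \<Longrightarrow> \<bar>\<phi> f\<bar> \<le> B * L1_norm f"
      using \<phi> unfolding L1_dual_def by blast
    then obtain h where h: "h \<in> L1" "\<And>f. f \<in> L1 \<Longrightarrow> \<phi> f = (LINT x|lebI. h x * f x)"
      by (rule L1_dual_representation[OF \<phi>]) blast+
    \<comment> \<open>By symmetry of the pairing of \<open>h\<close> with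
      \<open>D \<Lambda>\<close>, composing \<open>D\<close> with a weak functional is evaluation at
      the coordinate \<open>h\<close>.\<close>
    have "\<phi> (D \<Lambda>) = \<Lambda> h" if "\<Lambda> \<in> Z" for \<Lambda>
      using D[OF that] h by (simp add: K_def mult.commute)
    then have "D -` V \<inter> topspace (top_of_set Z) = Z \<inter> {\<Lambda>. \<Lambda> h \<in> U}"
      using D(1) by (auto simp: V K_def)
    moreover have "open ((\<lambda>\<Lambda>. \<Lambda> h) -` U)"
      by (rule open_vimage[OF \<open>open U\<close> continuous_on_product_coordinates])
    ultimately show "openin (top_of_set Z) (D -` V \<inter> topspace (top_of_set Z))"
      by (auto simp: openin_open vimage_def)
  next
    show "D ` topspace (top_of_set Z) \<subseteq> \<Union> {{f \<in> L1. \<phi> f \<in> U} | \<phi> U. \<phi> \<in> L1_dual \<and> open U}"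
      using D(1) topspace_weak_L1 unfolding weak_L1_def topology_generated_by_topspace
      by (auto simp: K_def)
  qed
  moreover have "compactin (top_of_set Z) Z"
    using \<open>compact Z\<close> by (simp add: compactin_subtopology)
  ultimately have cpt: "compactin weak_L1 (D ` Z)"
    by (rule image_compactin[rotated])
  \<comment> \<open>\<open>D\<close> picks one representative for each functional, so its image
    contains a representative of each class in \<open>K\<close>. As weakly open sets are saturated
    for equality almost everywhere, a cover of the image already covers \<open>K\<close>.\<close>
  have rep: "\<exists>\<Lambda>\<in>Z. AE x in lebI. D \<Lambda> x = g x" if g: "g \<in> K" for g
  proof -
    have gm: "g \<in> borel_measurable lebI" and ae: "AE x in lebI. \<bar>g x\<bar> \<le> C" and g1: "integrable lebI g"
      using g by (auto simp: K_def L1_def)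
    define \<Lambda> where "\<Lambda> f = (if f \<in> L1 then LINT x|lebI. g x * f x else 0)" for f
    have "\<Lambda> \<in> Z"
      using integrable_mult_bounded[OF _ gm ae] abs_LINT_mult_le[OF _ gm ae] L1_add L1_scale
      unfolding Z_def \<Lambda>_def by (auto simp: L1_def distrib_left mult.left_commute[of "g _"])
    moreover have "AE x in lebI. D \<Lambda> x = g x"
    proof (rule density_unique_real)
      fix A assume A: "A \<in> sets lebI"
      show "(LINT x:A|lebI. D \<Lambda> x) = (LINT x:A|lebI. g x)"
        using D(2)[OF \<open>\<Lambda> \<in> Z\<close> L1_indicator[OF A]] L1_indicator[OF A]
        by (simp add: \<Lambda>_def set_lebesgue_integral_def mult.commute)
    qed (use D(1)[OF \<open>\<Lambda> \<in> Z\<close>] g1 in \<open>auto simp: K_def L1_def\<close>)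
    ultimately show ?thesis by blast
  qed
  have "compactin weak_L1 K"
    unfolding compactin_def
  proof (intro conjI allI impI)
    show "K \<subseteq> topspace weak_L1"
      by (auto simp: topspace_weak_L1 K_def)
    fix \<U> assume \<U>: "(\<forall>U\<in>\<U>. openin weak_L1 U) \<and> K \<subseteq> \<Union> \<U>"
    moreover have "D ` Z \<subseteq> K"
      using D(1) by auto
    ultimately obtain \<F> where \<F>: "finite \<F>" "\<F> \<subseteq> \<U>" "D ` Z \<subseteq> \<Union> \<F>"
      using cpt unfolding compactin_def by (meson order_trans)
    have "K \<subseteq> \<Union> \<F>"
    proof
      fix g assume g: "g \<in> K"
      obtain \<Lambda> where \<Lambda>: "\<Lambda> \<in> Z" "AE x in lebI. D \<Lambda> x = g x"
        using rep[OF g] by blast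
      then obtain U where U: "U \<in> \<F>" "D \<Lambda> \<in> U"
        using \<F>(3) by auto
      then have "openin weak_L1 U"
        using \<U> \<F>(2) by blast
      then have "g \<in> U"
        using U(2) _ \<Lambda>(2) by (rule openin_weak_L1_cong_AE) (use g in \<open>simp add: K_def\<close>)
      with U show "g \<in> \<Union> \<F>" by auto
    qed
    with \<F> show "\<exists>\<F>. finite \<F> \<and> \<F> \<subseteq> \<U> \<and> K \<subseteq> \<Union> \<F>"
      by blast
  qed
  then show ?thesis
    by (simp add: K_def)
qed

text \<open>The weak closure stays in the closed order interval, which sits inside a weakly compact
  ball.\<close>

lemma weakly_precompact_if_bounded:
  assumes "\<And>f. f \<in> S \<Longrightarrow> f \<in> L1 \<and> (AE x in lebI. 0 \<le> f x \<and> f x \<le> C)"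
  shows "weakly_precompact S"
proof -
  let ?K = "{g \<in> L1. AE x in lebI. 0 \<le> g x \<and> g x \<le> C}"
  have "weak_L1 closure_of S \<subseteq> ?K"
    using assms by (intro closure_of_minimal closedin_weak_L1_order_interval) auto
  also have "\<dots> \<subseteq> {g \<in> L1. AE x in lebI. \<bar>g x\<bar> \<le> C}"
  proof -
    have "AE x in lebI. \<bar>g x\<bar> \<le> C" if "AE x in lebI. 0 \<le> g x \<and> g x \<le> C" for g
      using that by eventually_elim auto
    then show ?thesis by blast
  qed
  finally have "compactin weak_L1 (weak_L1 closure_of S)"
    by (intro closed_compactin[OF compactin_weak_L1_ball]) auto
  then show ?thesis
    using assms by (auto simp: weakly_precompact_def)
qed

section \<open>Cluster points in the weak topology\<close>

lemma weak_limit_point_in_closed: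
  assumes "weak_limit_point s g" "closedin weak_L1 K" "\<And>k. k \<ge> m \<Longrightarrow> s k \<in> K"
  shows "g \<in> K"
proof (rule ccontr)
  assume "g \<notin> K"
  then have "\<exists>\<^sub>\<infinity>k. s k \<in> L1 - K"
    using assms(1,2) unfolding weak_limit_point_def closedin_def topspace_weak_L1 by blast
  then show False
    using assms(3) by (auto simp: INFM_nat_le)
qed

lemma weak_limit_point_L1_dual:
  assumes g: "weak_limit_point s g" and \<phi>: "\<phi> \<in> L1_dual" and lim: "(\<lambda>k. \<phi> (s k)) \<longlonglongrightarrow> c"
  shows "\<phi> g = c"
proof (rule ccontr)
  assume "\<phi> g \<noteq> c"
  then obtain U V where UV: "open U" "open V" "\<phi> g \<in> U" "c \<in> V" "U \<inter> V = {}"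
    by (metis hausdorff)
  have "\<exists>\<^sub>\<infinity>k. s k \<in> {f \<in> L1. \<phi> f \<in> U}"
    using g openin_weak_L1_basis[OF \<phi> UV(1)] UV(3) unfolding weak_limit_point_def by blast
  moreover have "\<forall>\<^sub>\<infinity>k. \<phi> (s k) \<in> V"
    using topological_tendstoD[OF lim UV(2,4)] by (simp add: cofinite_eq_sequentially)
  then have "\<forall>\<^sub>\<infinity>k. s k \<notin> {f \<in> L1. \<phi> f \<in> U}"
    by eventually_elim (use UV(5) in auto)
  ultimately show False
    unfolding frequently_def by contradiction
qed

section \<open>Convex branches\<close>

text \<open>Secant slopes of a convex function increase with either endpoint, so their infimum is
  approached at \<open>p\<close> and equals the right derivative there.\<close>

lemma convex_on_secant_ge_right_deriv:
  fixes F :: "real \<Rightarrow> real"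
  assumes F: "convex_on {p..<q} F" and d: "(F has_real_derivative d) (at_right p)"
    and xy: "p \<le> x" "x < y" "y < q"
  shows "d * (y - x) \<le> F y - F x"
proof -
  have from_p: "d \<le> (F z - F p) / (z - p)" if z: "p < z" "z < q" for z
  proof (rule tendsto_upperbound)
    show "((\<lambda>t. (F t - F p) / (t - p)) \<longlongrightarrow> d) (at_right p)"
      using d by (simp add: has_field_derivative_iff)
    have "\<forall>\<^sub>F t in at_right p. t \<in> {p<..<z}"
      by (rule eventually_at_right_real[OF z(1)])
    then show "\<forall>\<^sub>F t in at_right p. (F t - F p) / (t - p) \<le> (F z - F p) / (z - p)"
    proof eventually_elim
      case (elim t)
      then have "(F p - F t) / (p - t) \<le> (F p - F z) / (p - z)"
        using z by (intro convex_on_slope_le(1)[OF F]) auto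
      then show ?case
        by (metis minus_diff_eq minus_divide_divide)
    qed
  qed simp
  \<comment> \<open>The slopes over \<open>[p, x]\<close>, \<open>[p, y]\<close> and
    \<open>[x, y]\<close> increase in this order.\<close>
  have "d \<le> (F y - F x) / (y - x)"
  proof (cases "x = p")
    case False
    then have "d \<le> (F x - F p) / (x - p)"
      using xy from_p by auto
    also have "\<dots> = (F p - F x) / (p - x)"
      by (metis minus_diff_eq minus_divide_divide)
    also have "\<dots> \<le> (F p - F y) / (p - y)"
      using False xy by (intro convex_on_slope_le(1)[OF F]) auto
    also have "\<dots> \<le> (F x - F y) / (x - y)"
      using False xy by (intro convex_on_slope_le(2)[OF F]) auto
    also have "\<dots> = (F y - F x) / (y - x)"
      by (metis minus_diff_eq minus_divide_divide)
    finally show ?thesis .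
  qed (use from_p xy in auto)
  then show ?thesis
    using xy by (simp add: le_divide_eq)
qed

text \<open>\<open>expand\<close> records the right derivative at \<open>p\<close> in the form of a
  lower bound for all secant slopes.\<close>

locale convex_branch =
  fixes F :: "real \<Rightarrow> real" and p q d :: real
  assumes convex: "convex_on {p..<q} F" and start: "F p = 0" and d_pos: "0 < d"
    and expand: "\<And>x y. p \<le> x \<Longrightarrow> x < y \<Longrightarrow> y < q \<Longrightarrow> d * (y - x) \<le> F y - F x"
begin

text \<open>The end \<open>b\<close> may cut the branch short: head sums over the first
  \<open>m\<close> cells see only the part of a branch to the left of \<open>m / k\<close>.\<close>

definition below :: "real \<Rightarrow> real \<Rightarrow> real set" where
  "below b y = {x \<in> {p..<b}. F x < y}"

lemma strict_mono_branch: "p \<le> x \<Longrightarrow> x < y \<Longrightarrow> y < q \<Longrightarrow> F x < F y"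
  using expand[of x y] mult_pos_pos[OF d_pos, of "y - x"] by linarith

lemma mono_branch: "p \<le> x \<Longrightarrow> x \<le> y \<Longrightarrow> y < q \<Longrightarrow> F x \<le> F y"
  using strict_mono_branch[of x y] by (cases "x = y") auto

lemma below_lmeasurable:
  assumes "b \<le> q"
  shows "below b y \<in> lmeasurable"
proof (rule measurable_convex)
  have "is_interval (below b y)"
    unfolding is_interval_1 below_def using assms
    by (auto intro: order_le_less_trans[OF mono_branch])
  then show "convex (below b y)"
    by (rule is_interval_convex)
  show "bounded (below b y)"
    by (rule bounded_subset[of "{p..b}"]) (auto simp: below_def)
qed

text \<open>The sublevel set is an interval starting at \<open>p\<close>, so it lies between
  \<open>{p..<s}\<close> and \<open>{p..s}\<close> for its supremum \<open>s\<close>. Inserting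
  \<open>p\<close> gives \<open>s = p\<close> when the set is empty.\<close>

lemma measure_below:
  assumes "b \<le> q"
  shows "measure lebesgue (below b y) = Sup (insert p (below b y)) - p"
proof -
  define s where "s = Sup (insert p (below b y))"
  have bdd: "bdd_above (insert p (below b y))"
    by (rule bdd_aboveI[of _ "max p b"]) (auto simp: below_def)
  have "p \<le> s"
    unfolding s_def by (rule cSup_upper[OF _ bdd]) simp
  have "{p..<s} \<subseteq> below b y"
  proof
    fix x assume x: "x \<in> {p..<s}"
    then obtain z where "z \<in> insert p (below b y)" "x < z"
      unfolding s_def using less_cSup_iff[OF _ bdd] by auto
    then show "x \<in> below b y"
      using x assms by (auto simp: below_def intro: order_le_less_trans[OF mono_branch, of x z])
  qed
  then have "measure lebesgue {p..<s} \<le> measure lebesgue (below b y)"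
    by (rule measure_mono_fmeasurable) (auto simp: below_lmeasurable[OF assms])
  moreover have "below b y \<subseteq> {p..s}"
    unfolding s_def using cSup_upper[OF _ bdd] by (auto simp: below_def)
  then have "measure lebesgue (below b y) \<le> measure lebesgue {p..s}"
    by (rule measure_mono_fmeasurable) (use below_lmeasurable[OF assms] in auto)
  ultimately show ?thesis
    using \<open>p \<le> s\<close> by (simp add: s_def)
qed

lemma measure_below_le:
  assumes "b \<le> q" "0 \<le> y"
  shows "measure lebesgue (below b y) \<le> y / d"
proof -
  have "below b y \<subseteq> {p..p + y / d}"
  proof
    fix x assume x: "x \<in> below b y"
    then have "d * (x - p) \<le> y"
      using expand[of p x] start assms by (cases "x = p") (auto simp: below_def)
    then show "x \<in> {p..p + y / d}"
      using x d_pos by (auto simp: below_def field_simps)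
  qed
  then have "measure lebesgue (below b y) \<le> measure lebesgue {p..p + y / d}"
    by (rule measure_mono_fmeasurable) (use below_lmeasurable[OF assms(1)] in auto)
  also have "\<dots> = y / d"
    using assms d_pos by simp
  finally show ?thesis .
qed

text \<open>The length below a height is essentially the inverse of a convex increasing function,
  hence concave in the height: the midpoint of points below \<open>y\<close> and
  \<open>y + 2 * \<delta>\<close> lies below \<open>y + \<delta>\<close>.\<close>

lemma measure_below_midpoint_concave:
  assumes b: "b \<le> q" and y: "0 \<le> y" and \<delta>: "0 < \<delta>"
  shows "measure lebesgue (below b y) + measure lebesgue (below b (y + 2 * \<delta>))
    \<le> 2 * measure lebesgue (below b (y + \<delta>))"
proof -
  define s where "s y = Sup (insert p (below b y))" for y
  have bdd: "bdd_above (insert p (below b y))" for y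
    by (rule bdd_aboveI[of _ "max p b"]) (auto simp: below_def)
  have mid: "x1 + x2 \<le> 2 * s (y + \<delta>)"
    if x1: "x1 \<in> insert p (below b y)" and x2: "x2 \<in> insert p (below b (y + 2 * \<delta>))" for x1 x2
  proof (cases "p < b")
    case True
    let ?m = "(1 - 1/2) *\<^sub>R x1 + (1/2) *\<^sub>R x2"
    have "x1 \<in> {p..<b}" "x2 \<in> {p..<b}"
      using x1 x2 True by (auto simp: below_def)
    moreover from this have "F ?m \<le> (1 - 1/2) * F x1 + (1/2) * F x2"
      using b by (intro convex_onD[OF convex]) auto
    \<comment> \<open>The first inequality is weak because \<open>x1\<close> may be the inserted
      point \<open>p\<close>, where \<open>F\<close> is 0; strictness at the midpoint comes from
      \<open>x2\<close>.\<close>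
    moreover have "F x1 \<le> y" "F x2 < y + 2 * \<delta>"
      using x1 x2 y \<delta> start by (auto simp: below_def)
    ultimately have "?m \<in> below b (y + \<delta>)"
      by (auto simp: below_def field_simps)
    then have "?m \<le> s (y + \<delta>)"
      unfolding s_def by (intro cSup_upper[OF _ bdd]) simp
    then show ?thesis by simp
  next
    case False
    then have "x1 = p" "x2 = p"
      using x1 x2 by (auto simp: below_def)
    moreover have "p \<le> s (y + \<delta>)"
      unfolding s_def by (intro cSup_upper[OF _ bdd]) simp
    ultimately show ?thesis by simp
  qed
  have "s (y + 2 * \<delta>) \<le> 2 * s (y + \<delta>) - x1" if "x1 \<in> insert p (below b y)" for x1
    unfolding s_def[of "y + 2 * \<delta>"] using mid[OF that] by (intro cSup_least) (auto simp: algebra_simps)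
  then have "s y \<le> 2 * s (y + \<delta>) - s (y + 2 * \<delta>)"
    unfolding s_def[of y] by (intro cSup_least) (auto simp: algebra_simps)
  then show ?thesis
    by (simp add: measure_below[OF b] s_def)
qed

text \<open>A strip is a difference of two sublevel sets, so concavity makes the lengths of
  successive strips of equal height decrease. This is \<open>head_sum\<close> for a single
  branch.\<close>

lemma measure_strip_antimono:
  assumes b: "b \<le> q" and y: "0 \<le> y" and \<delta>: "0 < \<delta>"
  shows "measure lebesgue {x \<in> {p..<b}. y + \<delta> \<le> F x \<and> F x < y + 2 * \<delta>}
    \<le> measure lebesgue {x \<in> {p..<b}. y \<le> F x \<and> F x < y + \<delta>}"
proof -
  have strip: "measure lebesgue {x \<in> {p..<b}. u \<le> F x \<and> F x < v}
      = measure lebesgue (below b v) - measure lebesgue (below b u)" if "u \<le> v" for u v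
  proof -
    have "{x \<in> {p..<b}. u \<le> F x \<and> F x < v} = below b v - below b u"
      by (auto simp: below_def)
    moreover have "below b u \<subseteq> below b v"
      using that by (auto simp: below_def)
    ultimately show ?thesis
      using measurable_measure_Diff[of "below b v" lebesgue "below b u"] below_lmeasurable[OF b]
      by (simp add: fmeasurableD)
  qed
  have "y \<le> y + \<delta>" "y + \<delta> \<le> y + 2 * \<delta>"
    using \<delta> by auto
  with measure_below_midpoint_concave[OF assms] show ?thesis
    using strip[of y "y + \<delta>"] strip[of "y + \<delta>" "y + 2 * \<delta>"] by linarith
qed

text \<open>The inverse branch is Lipschitz with constant \<open>1 / d\<close>, and Lipschitz maps
  preserve negligible sets.\<close>

lemma negligible_branch_vimage:
  assumes "negligible N"
  shows "negligible {x \<in> {p..<q}. F x \<in> N}"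
proof -
  define g where "g = inv_into {p..<q} F"
  have inj: "inj_on F {p..<q}"
    by (rule linorder_inj_onI) (auto dest: strict_mono_branch)
  have dist: "d * \<bar>y - x\<bar> \<le> \<bar>F y - F x\<bar>" if "x \<in> {p..<q}" "y \<in> {p..<q}" for x y
    using that expand[of x y] expand[of y x] by (cases x y rule: linorder_cases) (auto simp: abs_real_def)
  have "negligible (g ` (N \<inter> F ` {p..<q}))"
  proof (rule negligible_locally_Lipschitz_image)
    show "negligible (N \<inter> F ` {p..<q})"
      using assms by (rule negligible_subset) auto
    fix u assume u: "u \<in> N \<inter> F ` {p..<q}"
    have "norm (g v - g u) \<le> (1 / d) * norm (v - u)" if "v \<in> N \<inter> F ` {p..<q}" for v
    proof -
      obtain x y where "x \<in> {p..<q}" "u = F x" "y \<in> {p..<q}" "v = F y"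
        using u \<open>v \<in> _\<close> by auto
      then show ?thesis
        using dist[of x y] d_pos by (simp add: g_def inv_into_f_f[OF inj] field_simps)
    qed
    then show "\<exists>T B. open T \<and> u \<in> T \<and> (\<forall>v\<in>(N \<inter> F ` {p..<q}) \<inter> T. norm (g v - g u) \<le> B * norm (v - u))"
      by (intro exI[of _ UNIV] exI[of _ "1 / d"]) auto
  qed simp
  moreover have "{x \<in> {p..<q}. F x \<in> N} \<subseteq> g ` (N \<inter> F ` {p..<q})"
  proof
    fix x assume "x \<in> {x \<in> {p..<q}. F x \<in> N}"
    then have "g (F x) = x" "F x \<in> N \<inter> F ` {p..<q}"
      by (auto simp: g_def inv_into_f_f[OF inj])
    then show "x \<in> g ` (N \<inter> F ` {p..<q})"
      by (metis imageI)
  qed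
  ultimately show ?thesis
    by (rule negligible_subset)
qed

end

section \<open>Ulam cells and step functions\<close>

lemma ulam_cell_iff:
  "x \<in> ulam_cell k i \<longleftrightarrow> (real i - 1) / real k \<le> x \<and> (if i = k then x \<le> 1 else x < real i / real k)"
  by (simp add: ulam_cell_def)

lemma ulam_cell_subset: "i \<in> {1..k} \<Longrightarrow> ulam_cell k i \<subseteq> {0..1}"
proof
  fix x assume i: "i \<in> {1..k}" and x: "x \<in> ulam_cell k i"
  have "0 \<le> (real i - 1) / real k" "real i / real k \<le> 1"
    using i by auto
  with x show "x \<in> {0..1}"
    by (auto simp: ulam_cell_iff split: if_splits)
qed

lemma ulam_cell_sets: "i \<in> {1..k} \<Longrightarrow> ulam_cell k i \<in> sets lebI"
  using ulam_cell_subset[of i k] by (auto simp: sets_restrict_space_iff ulam_cell_def)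

lemma measure_lebI: "A \<in> sets lebI \<Longrightarrow> measure lebI A = measure lebesgue A"
  by (auto simp: measure_restrict_space sets_restrict_space_iff)

lemma measure_ulam_cell:
  assumes "i \<in> {1..k}"
  shows "measure lebI (ulam_cell k i) = 1 / real k"
proof -
  have "(real i - 1) / real k \<le> real i / real k" "(real k - 1) / real k \<le> 1"
    using assms by (auto simp: divide_simps)
  moreover have "real i / real k - (real i - 1) / real k = 1 / real k" "1 - (real k - 1) / real k = 1 / real k"
    using assms by (auto simp: field_simps)
  ultimately show ?thesis
    by (subst measure_lebI[OF ulam_cell_sets[OF assms]]) (auto simp: ulam_cell_def)
qed

lemma ulam_cell_unique:
  assumes "i \<in> {1..k}" "j \<in> {1..k}" "x \<in> ulam_cell k i" "x \<in> ulam_cell k j"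
  shows "i = j"
proof -
  have "\<not> i < j" if ij: "i \<in> {1..k}" "j \<in> {1..k}" "x \<in> ulam_cell k i" "x \<in> ulam_cell k j" for i j
  proof
    assume "i < j"
    then have "(real j - 1) / real k < real i / real k"
      using ij by (auto simp: ulam_cell_iff)
    then have "real j - 1 < real i"
      using ij by (auto simp: divide_less_cancel)
    with \<open>i < j\<close> show False by linarith
  qed
  with assms show ?thesis
    by (meson linorder_cases)
qed

lemma disjoint_family_ulam_cell: "disjoint_family_on (ulam_cell k) {1..k}"
  unfolding disjoint_family_on_def using ulam_cell_unique by blast

lemma ulam_cell_exists:
  assumes "1 \<le> k" "x \<in> {0..1}"
  obtains i where "i \<in> {1..k}" "x \<in> ulam_cell k i"
proof (cases "x = 1")
  case True
  then show ?thesis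
    using assms that[of k] by (auto simp: ulam_cell_iff field_simps)
next
  case False
  define i where "i = nat \<lfloor>real k * x\<rfloor>"
  have i: "real i \<le> real k * x" "real k * x < real i + 1"
    using assms unfolding i_def by (auto simp: of_nat_nat)
  moreover have "real k * x < real k"
    using assms False by auto
  ultimately have "Suc i \<le> k"
    by linarith
  moreover have "x \<in> ulam_cell k (Suc i)"
    using i assms by (auto simp: ulam_cell_iff field_simps)
  ultimately show ?thesis
    by (intro that[of "Suc i"]) auto
qed

lemma UN_ulam_cell: "1 \<le> k \<Longrightarrow> (\<Union>i\<in>{1..k}. ulam_cell k i) = {0..1}"
  using ulam_cell_subset ulam_cell_exists by (metis (no_types, lifting) UN_iff UN_least subsetI subset_antisym)

text \<open>The restriction to \<open>x < 1\<close> reflects the closed last cell: the point 1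
  belongs to cell \<open>k\<close> but is not below \<open>k / k\<close>.\<close>

lemma ulam_cell_less_iff:
  assumes "i \<in> {1..k}" "m \<in> {1..k}" "x \<in> ulam_cell k i" "x < 1"
  shows "x < real m / real k \<longleftrightarrow> i \<le> m"
proof
  assume "x < real m / real k"
  then have "(real i - 1) / real k < real m / real k"
    using assms by (auto simp: ulam_cell_iff)
  then show "i \<le> m"
    using assms by (auto simp: divide_less_cancel)
next
  assume "i \<le> m"
  have "x < real i / real k"
    using assms by (auto simp: ulam_cell_iff split: if_splits)
  also have "\<dots> \<le> real m / real k"
    using \<open>i \<le> m\<close> by (simp add: divide_right_mono)
  finally show "x < real m / real k" .
qed

section \<open>Functions constant on the cells\<close>

definition ulam_step :: "nat \<Rightarrow> (nat \<Rightarrow> real) \<Rightarrow> real \<Rightarrow> real" where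
  "ulam_step k c x = (\<Sum>i=1..k. c i * indicator (ulam_cell k i) x)"

lemma ulam_step_eq:
  assumes "i \<in> {1..k}" "x \<in> ulam_cell k i"
  shows "ulam_step k c x = c i"
proof -
  have "ulam_step k c x = (\<Sum>j\<in>{1..k}. if j = i then c i else 0)"
    unfolding ulam_step_def
  proof (intro sum.cong refl)
    fix j assume "j \<in> {1..k}"
    then have "x \<in> ulam_cell k j \<longleftrightarrow> j = i"
      using assms ulam_cell_unique by blast
    then show "c j * indicator (ulam_cell k j) x = (if j = i then c i else 0)"
      by (cases "j = i") simp_all
  qed
  with assms show ?thesis by simp
qed

lemma integrable_ulam_step: "integrable lebI (ulam_step k c)"
  unfolding ulam_step_def
  using finite_measure.emeasure_finite[OF finite_measure_lebesgue_on[of "{0..1::real}"]] ulam_cell_sets[of _ k]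
  by (intro Bochner_Integration.integrable_sum Bochner_Integration.integrable_mult_right)
    (auto simp: less_top[symmetric])

lemma set_LINT_ulam_step:
  assumes "A \<in> sets lebI"
  shows "(LINT x:A|lebI. ulam_step k c x) = (\<Sum>i=1..k. c i * measure lebI (A \<inter> ulam_cell k i))"
proof -
  have int: "integrable lebI (indicator (A \<inter> ulam_cell k i) :: real \<Rightarrow> real)" if "i \<in> {1..k}" for i
    using finite_measure.emeasure_finite[OF finite_measure_lebesgue_on[of "{0..1::real}"]] ulam_cell_sets[OF that] assms
    by (auto simp: less_top[symmetric])
  have "(LINT x:A|lebI. ulam_step k c x) = (LINT x|lebI. (\<Sum>i=1..k. c i * indicator (A \<inter> ulam_cell k i) x))"
    unfolding set_lebesgue_integral_def ulam_step_def real_scaleR_def sum_distrib_left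
    by (intro Bochner_Integration.integral_cong sum.cong) (auto simp: indicator_def)
  also have "\<dots> = (\<Sum>i=1..k. c i * (LINT x|lebI. indicator (A \<inter> ulam_cell k i) x))"
    using int by (subst Bochner_Integration.integral_sum) auto
  also have "\<dots> = (\<Sum>i=1..k. c i * measure lebI (A \<inter> ulam_cell k i))"
  proof (intro sum.cong refl)
    fix i assume "i \<in> {1..k}"
    then have "A \<inter> ulam_cell k i \<subseteq> {0..1}"
      using ulam_cell_subset by blast
    then show "c i * (LINT x|lebI. indicator (A \<inter> ulam_cell k i) x) = c i * measure lebI (A \<inter> ulam_cell k i)"
      by (simp add: Int_absorb2)
  qed
  finally show ?thesis .
qed

lemma antimono_on_ulam_step:
  assumes k: "1 \<le> k" and c: "antimono_on {1..k} c"
  shows "antimono_on {0..1} (ulam_step k c)"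
proof (rule monotone_onI)
  fix x y :: real assume x: "x \<in> {0..1}" and y: "y \<in> {0..1}" and "x \<le> y"
  obtain i where i: "i \<in> {1..k}" "x \<in> ulam_cell k i"
    using ulam_cell_exists[OF k x] by blast
  obtain j where j: "j \<in> {1..k}" "y \<in> ulam_cell k j"
    using ulam_cell_exists[OF k y] by blast
  have "i \<le> j"
  proof (cases "y < 1")
    case True
    then have "x < real j / real k"
      using ulam_cell_less_iff[OF j(1,1) j(2)] \<open>x \<le> y\<close> by simp
    with True \<open>x \<le> y\<close> show ?thesis
      using ulam_cell_less_iff[OF i(1) j(1) i(2)] by simp
  next
    case False
    then have "y \<in> ulam_cell k k"
      using y k by (auto simp: ulam_cell_iff field_simps)
    then have "j = k"
      using ulam_cell_unique[OF j(1) _ j(2), of k] k by simp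
    with i show ?thesis by simp
  qed
  then show "ulam_step k c x \<ge> ulam_step k c y"
    using monotone_onD[OF c i(1) j(1)] by (simp add: ulam_step_eq[OF i] ulam_step_eq[OF j])
qed

section \<open>Piecewise expanding maps and their Ulam matrices\<close>

lemma emeasure_density_set_LINT:
  fixes f :: "'a \<Rightarrow> real"
  assumes f: "integrable M f" "AE x in M. 0 \<le> f x" and A: "A \<in> sets M"
  shows "emeasure (density M (\<lambda>x. ennreal (f x))) A = ennreal (LINT x:A|M. f x)"
proof -
  have "emeasure (density M (\<lambda>x. ennreal (f x))) A = (\<integral>\<^sup>+x. ennreal (indicator A x * f x) \<partial>M)"
    using f(1) A by (subst emeasure_density) (auto intro!: nn_integral_cong split: split_indicator)
  also have "\<dots> = ennreal (LINT x|M. indicator A x * f x)"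
    using f(2) integrable_mult_indicator[OF A f(1)]
    by (intro nn_integral_eq_integral) (auto elim!: eventually_mono simp: indicator_def)
  finally show ?thesis
    by (simp add: set_lebesgue_integral_def)
qed

lemma AE_lebI_not_negligible: "negligible N \<Longrightarrow> AE x in lebI. x \<notin> N"
  by (auto simp: AE_restrict_space_iff negligible_iff_null_sets intro: AE_mp[OF AE_not_in])

text \<open>Branch 0 is the linear piece next to 0, with slope \<open>1 / r 0 > 1\<close>; all other
  branches start at positive points, where a nonincreasing density of mass one is at most
  \<open>1 / l j\<close>. The branches miss only the null set \<open>{1}\<close>.\<close>

locale piecewise_expanding_map =
  fixes T :: "real \<Rightarrow> real" and I :: "nat set" and l r d :: "nat \<Rightarrow> real"
  assumes finite_branches: "finite I"
    and branch: "\<And>j. j \<in> I \<Longrightarrow> convex_branch T (l j) (r j) (d j)"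
    and branch_less: "\<And>j. j \<in> I \<Longrightarrow> l j < r j"
    and disjoint_branches: "disjoint_family_on (\<lambda>j. {l j..<r j}) I"
    and branches_cover: "(\<Union>j\<in>I. {l j..<r j}) = {0..<1}"
    and maps_to: "T \<in> {0..1} \<rightarrow> {0..1}"
    and first_branch: "0 \<in> I" "l 0 = 0" "r 0 < 1" "d 0 = 1 / r 0"
    and first_branch_linear: "\<And>x. x \<in> {0..<r 0} \<Longrightarrow> T x = x / r 0"
    and other_branches: "\<And>j. j \<in> I \<Longrightarrow> j \<noteq> 0 \<Longrightarrow> 0 < l j"
begin

abbreviation vim :: "real set \<Rightarrow> real set" where
  "vim A \<equiv> T -` A \<inter> {0..1}"

lemma branch_subset: "j \<in> I \<Longrightarrow> {l j..<r j} \<subseteq> {0..<1}"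
  using branches_cover by blast

text \<open>This is nonsingularity of \<open>T\<close>, obtained branch by branch, with the point 1
  added.\<close>

lemma negligible_vim:
  assumes "negligible N"
  shows "negligible (vim N)"
proof -
  have "vim N \<subseteq> (\<Union>j\<in>I. {x \<in> {l j..<r j}. T x \<in> N}) \<union> {1}"
  proof
    fix x assume x: "x \<in> vim N"
    show "x \<in> (\<Union>j\<in>I. {x \<in> {l j..<r j}. T x \<in> N}) \<union> {1}"
    proof (cases "x = 1")
      case False
      then have "x \<in> (\<Union>j\<in>I. {l j..<r j})"
        using x branches_cover by auto
      then show ?thesis
        using x by auto
    qed simp
  qed
  moreover have "negligible ((\<Union>j\<in>I. {x \<in> {l j..<r j}. T x \<in> N}) \<union> {1})"
    using finite_branches convex_branch.negligible_branch_vimage[OF branch assms]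
    by (intro negligible_Un negligible_Union) auto
  ultimately show ?thesis
    by (rule negligible_subset[rotated])
qed

text \<open>A Lebesgue set is a Borel set together with a null set. Piecewise monotonicity handles
  the Borel part, nonsingularity the null part.\<close>

lemma measurable_T: "T \<in> lebI \<rightarrow>\<^sub>M lebI"
proof (rule measurableI)
  show "T x \<in> space lebI" if "x \<in> space lebI" for x
    using that maps_to by auto
next
  fix A assume A: "A \<in> sets lebI"
  \<comment> \<open>\<open>T0\<close> is constant on either side of the unit interval, so the whole
    line is covered by finitely many pieces on which it is monotone.\<close>
  define T0 where "T0 x = (if x \<in> {0..1} then T x else 0)" for x
  have T0: "T0 \<in> borel_measurable borel"
  proof (rule borel_measurable_piecewise_mono)
    let ?C = "(\<lambda>j. {l j..<r j}) ` I \<union> {{..<0}, {1}, {1<..}}"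
    show "countable ?C"
      using finite_branches by (simp add: countable_finite)
    show "c \<in> sets borel" if "c \<in> ?C" for c
      using that by auto
    show "mono_on c T0" if "c \<in> ?C" for c
    proof -
      have "mono_on {l j..<r j} T0" if j: "j \<in> I" for j
      proof (rule monotone_onI)
        fix x y assume xy: "x \<in> {l j..<r j}" "y \<in> {l j..<r j}" "x \<le> y"
        then have "x \<in> {0..1}" "y \<in> {0..1}"
          using branch_subset[OF j] by force+
        then show "T0 x \<le> T0 y"
          using xy convex_branch.mono_branch[OF branch[OF j], of x y] by (simp add: T0_def)
      qed
      moreover have "mono_on {..<0} T0" "mono_on {1} T0" "mono_on {1<..} T0"
        by (auto simp: monotone_on_def T0_def)
      ultimately show ?thesis
        using that by blast
    qed
    show "\<Union>?C = UNIV"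
      using branches_cover by (auto simp: not_less not_le)
  qed
  have "A \<in> sets lebesgue" "A \<subseteq> {0..1}"
    using A by (auto simp: sets_restrict_space_iff)
  then obtain B N N' where AB: "A = B \<union> N" "N \<subseteq> N'" "N' \<in> null_sets lborel" "B \<in> sets lborel"
    by (auto elim: sets_completionE)
  have "negligible N"
    using AB by (meson negligible_iff_null_sets negligible_subset null_sets_completionI)
  then have "vim N \<in> sets lebesgue"
    by (intro negligible_imp_sets negligible_vim)
  moreover have "T0 -` B \<inter> {0..1} \<in> sets lebesgue"
    using measurable_sets[OF T0, of B] AB(4) by auto
  moreover have "vim A = (T0 -` B \<inter> {0..1}) \<union> vim N"
    using AB by (auto simp: T0_def)
  ultimately show "T -` A \<inter> space lebI \<in> sets lebI"
    by (auto simp: sets_restrict_space_iff)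
qed

lemma vim_sets: "A \<in> sets lebI \<Longrightarrow> vim A \<in> sets lebI"
  using measurable_sets[OF measurable_T, of A] by simp

lemma AE_T_not_in:
  assumes "negligible N"
  shows "AE x in lebI. T x \<notin> N"
  using AE_lebI_not_negligible[OF negligible_vim[OF assms]] AE_space[of lebI]
  by eventually_elim auto

text \<open>\<open>h\<close> is the Radon-Nikodym derivative of the image under \<open>T\<close> of
  the measure with density \<open>f\<close>; nonsingularity provides absolute continuity.\<close>

lemma frobenius_perron_exists:
  assumes f: "f \<in> L1" "AE x in lebI. 0 \<le> f x"
  shows "\<exists>h. h \<in> L1 \<and> (\<forall>A\<in>sets lebI. (LINT x:A|lebI. h x) = (LINT x:vim A|lebI. f x))"
proof -
  define D where "D = density lebI (\<lambda>x. ennreal (f x))"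
  have f': "integrable lebI f"
    using f by (simp add: L1_def)
  have TD: "T \<in> D \<rightarrow>\<^sub>M lebI"
    using measurable_T by (simp add: D_def)
  have D_eq: "emeasure D A = ennreal (LINT x:A|lebI. f x)" if "A \<in> sets lebI" for A
    unfolding D_def by (rule emeasure_density_set_LINT[OF f' f(2) that])
  have N_eq: "emeasure (distr D lebI T) A = ennreal (LINT x:vim A|lebI. f x)" if "A \<in> sets lebI" for A
    using that TD D_eq[OF vim_sets[OF that]] by (simp add: emeasure_distr D_def)
  have "finite_measure (distr D lebI T)"
    by (rule finite_measureI) (simp add: N_eq)
  moreover have "absolutely_continuous lebI (distr D lebI T)"
    unfolding absolutely_continuous_def
  proof
    fix A assume A: "A \<in> null_sets lebI"
    then have "A \<in> null_sets lebesgue"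
      by (auto simp: null_sets_restrict_space)
    then have ae: "AE x in lebI. T x \<notin> A"
      by (intro AE_T_not_in) (simp add: negligible_iff_null_sets)
    have "(LINT x:vim A|lebI. f x) = 0"
      unfolding set_lebesgue_integral_def
      by (rule integral_eq_zero_AE) (use ae in eventually_elim, auto)
    with A show "A \<in> null_sets (distr D lebI T)"
      by (auto simp: null_sets_def N_eq)
  qed
  ultimately obtain h :: "real \<Rightarrow> real" where h: "integrable lebI h"
    "\<And>A. A \<in> sets lebI \<Longrightarrow> measure (distr D lebI T) A = (LINT x:A|lebI. h x)"
    by (rule lebI.Radon_Nikodym_integrable) simp_all
  have "(LINT x:A|lebI. h x) = (LINT x:vim A|lebI. f x)" if "A \<in> sets lebI" for A
  proof -
    have "0 \<le> (LINT x:vim A|lebI. f x)"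
      unfolding set_lebesgue_integral_def by (rule integral_nonneg_AE) (use f(2) in eventually_elim, auto)
    then show ?thesis
      using h(2)[OF that] by (simp add: measure_def N_eq[OF that])
  qed
  with h(1) show ?thesis
    by (auto simp: L1_def)
qed

lemma frobenius_perron:
  assumes "\<exists>h. h \<in> L1 \<and> (\<forall>A\<in>sets lebI. (LINT x:A|lebI. h x) = (LINT x:vim A|lebI. f x))"
  shows "frobenius_perron T f \<in> L1"
    and "A \<in> sets lebI \<Longrightarrow> (LINT x:A|lebI. frobenius_perron T f x) = (LINT x:vim A|lebI. f x)"
  using someI_ex[OF assms] unfolding frobenius_perron_def by blast+

text \<open>The hypothesis makes \<open>g\<close> itself an admissible choice for its image, and
  densities are unique almost everywhere.\<close>

lemma fixed_point_frobenius_perron: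
  assumes g: "g \<in> L1" and inv: "\<And>A. A \<in> sets lebI \<Longrightarrow> (LINT x:A|lebI. g x) = (LINT x:vim A|lebI. g x)"
  shows "fixed_point_L1 (frobenius_perron T) g"
proof -
  have ex: "\<exists>h. h \<in> L1 \<and> (\<forall>A\<in>sets lebI. (LINT x:A|lebI. h x) = (LINT x:vim A|lebI. g x))"
    using assms by blast
  have "AE x in lebI. frobenius_perron T g x = g x"
    using frobenius_perron[OF ex] g inv by (intro density_unique_real) (auto simp: L1_def)
  with g show ?thesis
    by (simp add: fixed_point_L1_def)
qed


section \<open>The Ulam matrix\<close>

definition transition :: "nat \<Rightarrow> nat \<Rightarrow> nat \<Rightarrow> real" where
  "transition k i j = real k * measure lebI (vim (ulam_cell k j) \<inter> ulam_cell k i)"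

text \<open>The union of the first \<open>m\<close> cells is an initial segment, so a head sum of a
  column is a sum over branches of strip lengths, each branch being cut at
  \<open>m / k\<close>.\<close>

lemma sum_transition:
  assumes m: "m \<in> {1..k}" and j: "j \<in> {1..k}"
  shows "(\<Sum>i=1..m. transition k i j) = real k * (\<Sum>b\<in>I. measure lebesgue
    {x \<in> {l b..<min (real m / real k) (r b)}. (real j - 1) / real k \<le> T x \<and> T x < real j / real k})"
proof -
  define S where "S b = {x \<in> {l b..<min (real m / real k) (r b)}.
    (real j - 1) / real k \<le> T x \<and> T x < real j / real k}" for b
  have k: "1 \<le> k"
    using m by auto
  have j_le: "0 \<le> (real j - 1) / real k" "real j / real k \<le> 1"
    using j by auto
  have S_sets: "S b \<in> sets lebI" if "b \<in> I" for b
  proof -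
    have "S b = vim {(real j - 1) / real k..<real j / real k} \<inter> {l b..<min (real m / real k) (r b)}"
      using branch_subset[OF that] by (force simp: S_def)
    moreover have "{(real j - 1) / real k..<real j / real k} \<subseteq> {0..1}"
      using j_le by auto
    then have "vim {(real j - 1) / real k..<real j / real k} \<in> sets lebI"
      by (intro vim_sets) (simp add: sets_restrict_space_iff)
    ultimately show ?thesis
      using branch_subset[OF that] by (auto simp: sets_restrict_space_iff)
  qed
  have V_sets: "vim (ulam_cell k j) \<inter> ulam_cell k i \<in> sets lebI" if "i \<in> {1..k}" for i
    using that j by (intro sets.Int vim_sets ulam_cell_sets)
  have "(\<Sum>i=1..m. measure lebI (vim (ulam_cell k j) \<inter> ulam_cell k i))
      = measure lebI (\<Union>i\<in>{1..m}. vim (ulam_cell k j) \<inter> ulam_cell k i)"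
  proof (rule lebI.finite_measure_finite_Union[symmetric])
    have "disjoint_family_on (ulam_cell k) {1..m}"
      using m by (intro disjoint_family_on_mono[OF _ disjoint_family_ulam_cell]) auto
    then show "disjoint_family_on (\<lambda>i. vim (ulam_cell k j) \<inter> ulam_cell k i) {1..m}"
      by (fastforce simp: disjoint_family_on_def)
    show "(\<lambda>i. vim (ulam_cell k j) \<inter> ulam_cell k i) ` {1..m} \<subseteq> sets lebI"
      using V_sets m by auto
  qed simp
  also have "\<dots> = measure lebI (\<Union>b\<in>I. S b)"
  proof (rule measure_eq_AE)
    \<comment> \<open>Closed last cells and half-open strips disagree only where
      \<open>x = 1\<close> or \<open>T x = 1\<close>, and both sets are null.\<close>
    have "AE x in lebI. x \<notin> {1}" "AE x in lebI. T x \<notin> {1}"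
      by (intro AE_lebI_not_negligible AE_T_not_in negligible_sing)+
    then show "AE x in lebI. x \<in> (\<Union>i\<in>{1..m}. vim (ulam_cell k j) \<inter> ulam_cell k i) \<longleftrightarrow> x \<in> (\<Union>b\<in>I. S b)"
      using AE_space[of lebI]
    proof eventually_elim
      case (elim x)
      then have x: "x \<in> {0..1}" "x < 1" and Tx: "T x < 1"
        using maps_to by (force simp: order_less_le)+
      obtain i where i: "i \<in> {1..k}" "x \<in> ulam_cell k i"
        using ulam_cell_exists[OF k x(1)] by blast
      have "(\<exists>i\<in>{1..m}. x \<in> ulam_cell k i) \<longleftrightarrow> i \<le> m"
      proof
        assume "\<exists>i\<in>{1..m}. x \<in> ulam_cell k i"
        then obtain i' where i': "i' \<in> {1..m}" "x \<in> ulam_cell k i'"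
          by blast
        then have "i = i'"
          using m by (intro ulam_cell_unique[OF i(1) _ i(2)]) auto
        with i' show "i \<le> m"
          by simp
      qed (use i in auto)
      also have "\<dots> \<longleftrightarrow> x < real m / real k"
        using ulam_cell_less_iff[OF i(1) m i(2) x(2)] by simp
      finally have 1: "(\<exists>i\<in>{1..m}. x \<in> ulam_cell k i) \<longleftrightarrow> x < real m / real k" .
      have 2: "T x \<in> ulam_cell k j \<longleftrightarrow> (real j - 1) / real k \<le> T x \<and> T x < real j / real k"
        using Tx k by (auto simp: ulam_cell_iff)
      have "x \<in> (\<Union>b\<in>I. {l b..<r b})"
        using x branches_cover by simp
      then show ?case
        using 1 2 x(1) by (auto simp: S_def)
    qed
    show "(\<Union>i\<in>{1..m}. vim (ulam_cell k j) \<inter> ulam_cell k i) \<in> sets lebI"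
      using V_sets m by (intro sets.finite_UN) auto
    show "(\<Union>b\<in>I. S b) \<in> sets lebI"
      using S_sets finite_branches by (intro sets.finite_UN) auto
  qed
  also have "\<dots> = (\<Sum>b\<in>I. measure lebI (S b))"
  proof (rule lebI.finite_measure_finite_Union[OF finite_branches])
    show "disjoint_family_on S I"
      using disjoint_branches unfolding disjoint_family_on_def S_def by fastforce
  qed (use S_sets in auto)
  also have "\<dots> = (\<Sum>b\<in>I. measure lebesgue (S b))"
    by (intro sum.cong refl measure_lebI S_sets)
  finally show ?thesis
    unfolding transition_def S_def sum_distrib_left[symmetric] by (rule arg_cong)
qed

text \<open>\<open>head_sum\<close> is the strip estimate added up over the branches, and
  \<open>spread\<close> comes from the expansion of the linear first branch.\<close>

lemma monotone_stochastic_transition: "monotone_stochastic_matrix k (transition k)"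
proof
  show "0 \<le> transition k i j" for i j
    by (simp add: transition_def)
next
  fix i assume i: "i \<in> {1..k}"
  then have k: "1 \<le> k" by simp
  have "(\<Sum>j=1..k. measure lebI (vim (ulam_cell k j) \<inter> ulam_cell k i))
      = measure lebI (\<Union>j\<in>{1..k}. vim (ulam_cell k j) \<inter> ulam_cell k i)"
  proof (rule lebI.finite_measure_finite_Union[symmetric])
    show "disjoint_family_on (\<lambda>j. vim (ulam_cell k j) \<inter> ulam_cell k i) {1..k}"
      using disjoint_family_ulam_cell[of k] unfolding disjoint_family_on_def by blast
    show "(\<lambda>j. vim (ulam_cell k j) \<inter> ulam_cell k i) ` {1..k} \<subseteq> sets lebI"
      using i by (auto intro!: sets.Int[of "vim _"] vim_sets ulam_cell_sets)
  qed simp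
  also have "(\<Union>j\<in>{1..k}. vim (ulam_cell k j) \<inter> ulam_cell k i) = vim (\<Union>j\<in>{1..k}. ulam_cell k j) \<inter> ulam_cell k i"
    by auto
  also have "\<dots> = ulam_cell k i"
    using maps_to ulam_cell_subset[OF i] unfolding UN_ulam_cell[OF k] by auto
  finally show "(\<Sum>j=1..k. transition k i j) = 1"
    unfolding transition_def sum_distrib_left[symmetric] measure_ulam_cell[OF i] using k by simp
next
  fix m j assume m: "m \<in> {1..k}" and j: "j \<in> {1..<k}"
  define \<delta> where "\<delta> = 1 / real k"
  define y where "y = (real j - 1) / real k"
  have eq: "(real (Suc j) - 1) / real k = y + \<delta>" "real (Suc j) / real k = y + 2 * \<delta>" "real j / real k = y + \<delta>"
    by (simp_all add: y_def \<delta>_def add_divide_distrib[symmetric])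
  have "0 \<le> y" "0 < \<delta>"
    using j by (auto simp: y_def \<delta>_def)
  have j': "j \<in> {1..k}" "Suc j \<in> {1..k}"
    using j by auto
  show "(\<Sum>i=1..m. transition k i (Suc j)) \<le> (\<Sum>i=1..m. transition k i j)"
    unfolding sum_transition[OF m j'(1)] sum_transition[OF m j'(2)] eq y_def[symmetric]
    by (intro mult_left_mono sum_mono convex_branch.measure_strip_antimono[OF branch] \<open>0 \<le> y\<close> \<open>0 < \<delta>\<close>) auto
next
  fix m assume m: "m \<in> {1..<k}"
  have m': "m \<in> {1..k}" "Suc m \<in> {1..k}"
    using m by auto
  define S where "S b = {x \<in> {l b..<min (real m / real k) (r b)}.
    (real (Suc m) - 1) / real k \<le> T x \<and> T x < real (Suc m) / real k}" for b
  have r0: "0 < r 0" "r 0 < 1"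
    using branch_less[OF first_branch(1)] first_branch by auto
  \<comment> \<open>\<open>u\<close> is the preimage of \<open>m / k\<close> under the first branch,
    and \<open>v\<close> is the preimage of the next grid point, cut at \<open>m / k\<close>. Points
    of \<open>{u..<v}\<close> lie in the first \<open>m\<close> cells and are mapped to cell
    \<open>Suc m\<close>.\<close>
  define u v where "u = r 0 * (real m / real k)" and "v = min (real m / real k) (r 0 * (real (Suc m) / real k))"
  have "0 < real m / real k"
    using m by auto
  then have "u < real m / real k"
    unfolding u_def using mult_strict_right_mono[OF r0(2)] by fastforce
  moreover have "u < r 0 * (real (Suc m) / real k)"
    unfolding u_def using r0 m by (intro mult_strict_left_mono divide_strict_right_mono) auto
  ultimately have "u < v"
    by (simp add: v_def)
  have "r 0 * (real (Suc m) / real k) \<le> r 0"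
    using r0 m by (intro mult_left_le) auto
  then have "v \<le> r 0"
    by (simp add: v_def)
  have "0 \<le> u"
    using r0 by (simp add: u_def)
  have "{u..<v} \<subseteq> S 0"
  proof
    fix x assume x: "x \<in> {u..<v}"
    then have "T x = x / r 0"
      using \<open>0 \<le> u\<close> \<open>v \<le> r 0\<close> by (intro first_branch_linear) auto
    moreover have "real m / real k \<le> x / r 0" "x / r 0 < real (Suc m) / real k"
      using x r0 by (auto simp: u_def v_def pos_le_divide_eq pos_divide_less_eq mult.commute)
    ultimately show "x \<in> S 0"
      using x \<open>0 \<le> u\<close> \<open>v \<le> r 0\<close> by (auto simp: S_def first_branch v_def)
  qed
  moreover have "S 0 \<subseteq> {0..<r 0}"
    by (auto simp: S_def first_branch)
  moreover have "S 0 \<in> lmeasurable"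
  proof -
    have "S 0 = convex_branch.below T (l 0) (min (real m / real k) (r 0)) (real (Suc m) / real k)
        - convex_branch.below T (l 0) (min (real m / real k) (r 0)) ((real (Suc m) - 1) / real k)"
      by (auto simp: S_def convex_branch.below_def[OF branch[OF first_branch(1)]])
    then show ?thesis
      by (simp only:) (intro fmeasurable_Diff fmeasurableD convex_branch.below_lmeasurable[OF branch[OF first_branch(1)]] min.cobounded2)
  qed
  ultimately have "measure lebesgue {u..<v} \<le> measure lebesgue (S 0)"
    by (intro measure_mono_fmeasurable) auto
  then have "0 < measure lebesgue (S 0)"
    using \<open>u < v\<close> by simp
  also have "\<dots> \<le> (\<Sum>b\<in>I. measure lebesgue (S b))"
    using first_branch finite_branches by (intro member_le_sum) auto
  finally have "0 < (\<Sum>i=1..m. transition k i (Suc m))"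
    unfolding sum_transition[OF m'] S_def using m by simp
  then show "\<exists>i\<in>{1..m}. 0 < transition k i (Suc m)"
    by (metis sum_nonpos not_le)
qed

text \<open>On branch \<open>b\<close> the preimage has length at most \<open>y / d b\<close>, and
  \<phi> is at most its value at the left end \<open>l b\<close>. For \<open>b \<noteq> 0\<close>
  that value is at most \<open>1 / l b\<close>; branch 0 starts at 0, so \<phi> 0 remains, with
  factor \<open>1 / d 0 = r 0\<close>.\<close>

lemma set_LINT_vim_antimono_le:
  assumes anti: "antimono_on {0..1} \<phi>" and nonneg: "\<And>x. x \<in> {0..1} \<Longrightarrow> 0 \<le> \<phi> x"
    and int: "integrable lebI \<phi>" and total: "(LINT x|lebI. \<phi> x) = 1" and y: "0 \<le> y" "y \<le> 1"
  shows "(LINT x:vim {0..<y}|lebI. \<phi> x) \<le> y * (r 0 * \<phi> 0 + (\<Sum>b\<in>I - {0}. 1 / (l b * d b)))"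
proof -
  define B where "B b = convex_branch.below T (l b) (r b) y" for b
  have B_eq: "B b = {x \<in> {l b..<r b}. T x < y}" if "b \<in> I" for b
    unfolding B_def by (rule convex_branch.below_def[OF branch[OF that]])
  have l: "l b \<in> {0..1}" if "b \<in> I" for b
    using branch_subset[OF that] branch_less[OF that] by force
  have B_sets: "B b \<in> sets lebI" if "b \<in> I" for b
  proof -
    have "B b \<in> lmeasurable"
      unfolding B_def by (rule convex_branch.below_lmeasurable[OF branch[OF that]]) simp
    then show ?thesis
      using branch_subset[OF that] by (force simp: sets_restrict_space_iff B_eq[OF that] fmeasurableD)
  qed
  have B_le: "measure lebI (B b) \<le> y / d b" if "b \<in> I" for b
    unfolding measure_lebI[OF B_sets[OF that]] unfolding B_def
    by (rule convex_branch.measure_below_le[OF branch[OF that]]) (use y in auto)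
  \<comment> \<open>A nonincreasing \<phi> is at least \<phi> x on \<open>{0..x}\<close>, and the
    total mass is one.\<close>
  have \<phi>_le: "\<phi> x \<le> 1 / x" if x: "0 < x" "x \<le> 1" for x
  proof -
    have x_sets: "{0..x} \<in> sets lebI"
      using x by (simp add: sets_restrict_space_iff)
    have "(LINT t|lebI. \<phi> x * indicator {0..x} t) \<le> (LINT t|lebI. \<phi> t)"
    proof (rule integral_mono)
      show "integrable lebI (\<lambda>t. \<phi> x * indicator {0..x} t)"
        using L1_indicator[OF x_sets] by (simp add: L1_def)
      show "\<phi> x * indicator {0..x} t \<le> \<phi> t" if "t \<in> space lebI" for t
        using that x monotone_onD[OF anti, of t x] nonneg[of t] by (auto simp: indicator_def)
    qed (fact int)
    moreover have "measure lebI {0..x} = x"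
      using x by (simp add: measure_lebI[OF x_sets])
    ultimately have "\<phi> x * x \<le> 1"
      using x by (simp add: total Int_absorb2)
    then show ?thesis
      using x by (simp add: field_simps)
  qed
  have "(LINT x:vim {0..<y}|lebI. \<phi> x) \<le> (LINT x|lebI. (\<Sum>b\<in>I. \<phi> (l b) * indicator (B b) x))"
    unfolding set_lebesgue_integral_def
  proof (rule integral_mono_AE)
    have "{0..<y} \<in> sets lebI"
      using y by (auto simp: sets_restrict_space_iff)
    then show "integrable lebI (\<lambda>x. indicator (vim {0..<y}) x *\<^sub>R \<phi> x)"
      by (intro integrable_mult_indicator vim_sets int)
    show "integrable lebI (\<lambda>x. \<Sum>b\<in>I. \<phi> (l b) * indicator (B b) x)"
      using L1_indicator[OF B_sets] by (auto simp: L1_def)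
    show "AE x in lebI. indicator (vim {0..<y}) x *\<^sub>R \<phi> x \<le> (\<Sum>b\<in>I. \<phi> (l b) * indicator (B b) x)"
      using AE_lebI_not_negligible[OF negligible_sing[of 1]] AE_space[of lebI]
    proof eventually_elim
      case (elim x)
      have nn: "0 \<le> (\<Sum>b\<in>I. \<phi> (l b) * indicator (B b) x)"
        using nonneg l by (intro sum_nonneg mult_nonneg_nonneg) auto
      show ?case
      proof (cases "x \<in> vim {0..<y}")
        case True
        have "x \<in> (\<Union>b\<in>I. {l b..<r b})"
          using elim branches_cover by auto
        then obtain b where b: "b \<in> I" "x \<in> {l b..<r b}"
          by auto
        have "\<phi> x \<le> \<phi> (l b)"
          using b elim l[OF b(1)] by (intro monotone_onD[OF anti]) auto
        also have "\<dots> = \<phi> (l b) * indicator (B b) x"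
          using b True by (simp add: B_eq)
        also have "\<dots> \<le> (\<Sum>b\<in>I. \<phi> (l b) * indicator (B b) x)"
          using nonneg l b finite_branches by (intro member_le_sum) auto
        finally show ?thesis
          using True by simp
      qed (use nn in simp)
    qed
  qed
  also have "\<dots> = (\<Sum>b\<in>I. LINT x|lebI. \<phi> (l b) * indicator (B b) x)"
    using L1_indicator[OF B_sets] by (intro Bochner_Integration.integral_sum) (auto simp: L1_def)
  also have "\<dots> = (\<Sum>b\<in>I. \<phi> (l b) * measure lebI (B b))"
    using sets.sets_into_space[OF B_sets] by (intro sum.cong refl) (simp add: Int_absorb2)
  also have "\<dots> = \<phi> 0 * measure lebI (B 0) + (\<Sum>b\<in>I - {0}. \<phi> (l b) * measure lebI (B b))"
    using finite_branches first_branch by (simp add: sum.remove)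
  also have "\<dots> \<le> \<phi> 0 * (y / d 0) + (\<Sum>b\<in>I - {0}. 1 / l b * (y / d b))"
    using B_le other_branches l first_branch(1,2)
    by (intro add_mono sum_mono mult_mono nonneg \<phi>_le) (auto intro: order_less_imp_le)
  also have "\<dots> = y * (r 0 * \<phi> 0 + (\<Sum>b\<in>I - {0}. 1 / (l b * d b)))"
    by (simp add: first_branch distrib_left sum_distrib_left)
  finally show ?thesis .
qed

end

section \<open>Fixed points of Ulam operators and their weak limits\<close>

lemma set_LINT_cong_AE_lebI:
  fixes f g :: "real \<Rightarrow> real"
  assumes "integrable lebI f" "integrable lebI g" "A \<in> sets lebI" "AE x in lebI. f x = g x"
  shows "(LINT x:A|lebI. f x) = (LINT x:A|lebI. g x)"
  unfolding set_lebesgue_integral_def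
  using assms(4) integrable_mult_indicator[OF assms(3,1)] integrable_mult_indicator[OF assms(3,2)]
  by (intro integral_cong_AE) auto

lemma set_LINT_nonneg_lebI:
  fixes f :: "real \<Rightarrow> real"
  assumes "AE x in lebI. 0 \<le> f x"
  shows "0 \<le> (LINT x:A|lebI. f x)"
  unfolding set_lebesgue_integral_def by (rule integral_nonneg_AE) (use assms in eventually_elim, auto)

lemma set_LINT_mono_set_lebI:
  fixes f :: "real \<Rightarrow> real"
  assumes "integrable lebI f" "AE x in lebI. 0 \<le> f x" "A \<in> sets lebI" "B \<in> sets lebI" "A \<subseteq> B"
  shows "(LINT x:A|lebI. f x) \<le> (LINT x:B|lebI. f x)"
  unfolding set_lebesgue_integral_def
proof (rule integral_mono_AE)
  show "AE x in lebI. indicator A x *\<^sub>R f x \<le> indicator B x *\<^sub>R f x"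
    using assms(2) by eventually_elim (use assms(5) in \<open>auto simp: indicator_def\<close>)
qed (intro integrable_mult_indicator assms)+

context piecewise_expanding_map
begin

text \<open>The solution \<open>C\<close> of \<open>C = r 0 * C + s\<close>, where \<open>s\<close>
  is the sum in the numerator.\<close>

definition ulam_bound :: real where
  "ulam_bound = (\<Sum>b\<in>I - {0}. 1 / (l b * d b)) / (1 - r 0)"

text \<open>Substituting the step form of \<open>f\<close> into the integrals that define its
  coefficients shows that these form an invariant vector of the matrix. They are therefore
  nonincreasing, and bounding the first one suffices.\<close>

lemma ulam_fixed_point_step:
  assumes k: "1 \<le> k" and f: "normalized_ulam_fixed_point T k f"
  obtains c where "AE x in lebI. f x = ulam_step k c x"
    "\<And>i. i \<in> {1..k} \<Longrightarrow> 0 \<le> c i" "\<And>i. i \<in> {1..k} \<Longrightarrow> c i \<le> ulam_bound"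
    "\<And>i. i \<in> {1..k} \<Longrightarrow> c i = real k * (LINT x:vim (ulam_cell k i)|lebI. f x)"
proof -
  define F where "F = frobenius_perron T f"
  define c where "c j = real k * (LINT x:vim (ulam_cell k j)|lebI. f x)" for j
  have fL1: "f \<in> L1" and f0: "AE x in lebI. 0 \<le> f x" and f1: "(LINT x|lebI. f x) = 1"
    and fp: "AE x in lebI. ulam_operator T k f x = f x"
    using f by (auto simp: normalized_ulam_fixed_point_def ulam_space_def fixed_point_L1_def)
  have fint: "integrable lebI f"
    using fL1 by (simp add: L1_def)
  have proj: "ulam_operator T k f x = ulam_step k c x" for x
    unfolding ulam_operator_def ulam_projection_def ulam_step_def c_def
    using k by (intro sum.cong refl)
      (simp add: measure_ulam_cell frobenius_perron(2)[OF frobenius_perron_exists[OF fL1 f0]] ulam_cell_sets)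
  have ae: "AE x in lebI. f x = ulam_step k c x"
    using fp by eventually_elim (simp add: proj)
  have step: "(LINT x:A|lebI. f x) = (LINT x:A|lebI. ulam_step k c x)" if "A \<in> sets lebI" for A
    by (rule set_LINT_cong_AE_lebI[OF fint integrable_ulam_step that ae])
  have c0: "0 \<le> c i" for i
    using set_LINT_nonneg_lebI[OF f0] by (simp add: c_def)
  interpret M: monotone_stochastic_matrix k "transition k"
    by (rule monotone_stochastic_transition)
  have inv: "M.act c j = c j" if "j \<in> {1..k}" for j
    unfolding c_def[of j] step[OF vim_sets[OF ulam_cell_sets[OF that]]]
      set_LINT_ulam_step[OF vim_sets[OF ulam_cell_sets[OF that]]] M.act_def transition_def sum_distrib_left
    by (intro sum.cong refl) simp
  have c_anti: "antimono_on {1..k} c"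
    using M.invariant_antimono[OF c0 inv] .
  let ?\<phi> = "ulam_step k c"
  have zero: "0 \<in> ulam_cell k 1" and one: "1 \<in> {1..k}"
    using k by (auto simp: ulam_cell_iff)
  have \<phi>0: "?\<phi> 0 = c 1"
    by (rule ulam_step_eq[OF one zero])
  have "c 1 \<le> ulam_bound"
  proof -
    have k': "0 \<le> 1 / real k" "1 / real k \<le> 1"
      using k by auto
    have "{0..<1 / real k} \<in> sets lebI"
      using k' by (auto simp: sets_restrict_space_iff)
    note sets = vim_sets[OF this] vim_sets[OF ulam_cell_sets[OF one]]
    have "c 1 = real k * (LINT x:vim (ulam_cell k 1)|lebI. ?\<phi> x)"
      using step[OF vim_sets[OF ulam_cell_sets[OF one]]] by (simp add: c_def)
    \<comment> \<open>The first cell differs from \<open>{0..<1 / real k}\<close> only for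
      \<open>k = 1\<close>, where it also contains 1.\<close>
    also have "(LINT x:vim (ulam_cell k 1)|lebI. ?\<phi> x) = (LINT x:vim {0..<1 / real k}|lebI. ?\<phi> x)"
      unfolding set_lebesgue_integral_def
    proof (rule integral_cong_AE)
      have "AE x in lebI. T x \<notin> {1}"
        by (intro AE_T_not_in negligible_sing)
      then show "AE x in lebI. indicator (vim (ulam_cell k 1)) x *\<^sub>R ?\<phi> x = indicator (vim {0..<1 / real k}) x *\<^sub>R ?\<phi> x"
        using AE_space[of lebI]
      proof eventually_elim
        case (elim x)
        then have "T x < 1" "0 \<le> T x"
          using maps_to by (force simp: order_less_le)+
        then have "T x \<in> ulam_cell k 1 \<longleftrightarrow> T x \<in> {0..<1 / real k}"
          by (auto simp: ulam_cell_iff)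
        then show ?case
          by (simp add: indicator_def)
      qed
    qed (use integrable_mult_indicator[OF sets(1) integrable_ulam_step]
        integrable_mult_indicator[OF sets(2) integrable_ulam_step] in auto)
    also have "\<dots> \<le> 1 / real k * (r 0 * ?\<phi> 0 + (\<Sum>b\<in>I - {0}. 1 / (l b * d b)))"
    proof (rule set_LINT_vim_antimono_le[OF antimono_on_ulam_step[OF k c_anti] _ integrable_ulam_step _ k'])
      show "0 \<le> ?\<phi> x" for x
        unfolding ulam_step_def using c0 by (intro sum_nonneg mult_nonneg_nonneg) auto
      show "(LINT x|lebI. ?\<phi> x) = 1"
        using f1 ae fint integrable_ulam_step[of k c] by (subst integral_cong_AE[where g = f]) auto
    qed
    \<comment> \<open>Since \<open>r 0 < 1\<close>, the first term on the right can be absorbed on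
      the left.\<close>
    finally have "c 1 \<le> r 0 * c 1 + (\<Sum>b\<in>I - {0}. 1 / (l b * d b))"
      using k by (simp add: \<phi>0)
    then show ?thesis
      using first_branch by (simp add: ulam_bound_def pos_le_divide_eq algebra_simps)
  qed
  then have "c i \<le> ulam_bound" if "i \<in> {1..k}" for i
    using monotone_onD[OF c_anti one that] that by auto
  with ae c0 c_def that show ?thesis
    by blast
qed

lemma ulam_fixed_point_bounded:
  assumes k: "1 \<le> k" and f: "normalized_ulam_fixed_point T k f"
  shows "f \<in> L1" "AE x in lebI. 0 \<le> f x \<and> f x \<le> ulam_bound"
proof -
  show "f \<in> L1"
    using f by (auto simp: normalized_ulam_fixed_point_def ulam_space_def)
  obtain c where c: "AE x in lebI. f x = ulam_step k c x"
    "\<And>i. i \<in> {1..k} \<Longrightarrow> 0 \<le> c i" "\<And>i. i \<in> {1..k} \<Longrightarrow> c i \<le> ulam_bound"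
    using ulam_fixed_point_step[OF k f] by metis
  show "AE x in lebI. 0 \<le> f x \<and> f x \<le> ulam_bound"
    using c(1) AE_space[of lebI]
  proof eventually_elim
    case (elim x)
    then obtain i where i: "i \<in> {1..k}" "x \<in> ulam_cell k i"
      using ulam_cell_exists[OF k, of x] by auto
    then show ?case
      using elim c(2,3)[OF i(1)] by (simp add: ulam_step_eq)
  qed
qed

section \<open>The defect of invariance on a set\<close>

definition defect :: "real set \<Rightarrow> (real \<Rightarrow> real) \<Rightarrow> real" where
  "defect A f = (LINT x:A|lebI. f x) - (LINT x:vim A|lebI. f x)"

text \<open>The defect is integration against a difference of two indicators, which is bounded by
  1.\<close>

lemma defect_in_L1_dual:
  assumes "A \<in> sets lebI"
  shows "defect A \<in> L1_dual"
proof -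
  let ?h = "\<lambda>x. indicator A x - indicator (vim A) x :: real"
  have [measurable]: "A \<in> sets lebI" "vim A \<in> sets lebI"
    using assms vim_sets by auto
  have "(\<lambda>f. LINT x|lebI. ?h x * f x) \<in> L1_dual"
    by (rule LINT_mult_in_L1_dual[where C = 1]) (measurable, auto simp: indicator_def)
  moreover have "(LINT x|lebI. ?h x * f x) = defect A f" if "f \<in> L1" for f
    using that assms vim_sets[OF assms] integrable_mult_indicator[of _ lebI f]
    by (simp add: defect_def set_lebesgue_integral_def left_diff_distrib L1_def)
  ultimately show ?thesis
    by (auto simp: L1_dual_def L1_add L1_scale)
qed

text \<open>Averaging over cells preserves the integral over each cell, so a fixed point of the Ulam
  operator is exactly invariant on cells.\<close>

lemma defect_ulam_cell:
  assumes k: "1 \<le> k" and f: "normalized_ulam_fixed_point T k f" and j: "j \<in> {1..k}"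
  shows "defect (ulam_cell k j) f = 0" "(LINT x:ulam_cell k j|lebI. f x) \<le> ulam_bound / real k"
proof -
  obtain c where c: "AE x in lebI. f x = ulam_step k c x"
    "\<And>i. i \<in> {1..k} \<Longrightarrow> c i \<le> ulam_bound"
    "\<And>i. i \<in> {1..k} \<Longrightarrow> c i = real k * (LINT x:vim (ulam_cell k i)|lebI. f x)"
    using ulam_fixed_point_step[OF k f] by metis
  have "(LINT x:ulam_cell k j|lebI. f x) = (LINT x:ulam_cell k j|lebI. ulam_step k c x)"
    using ulam_fixed_point_bounded(1)[OF k f] c(1)
    by (intro set_LINT_cong_AE_lebI integrable_ulam_step ulam_cell_sets j) (auto simp: L1_def)
  also have "\<dots> = (\<Sum>i=1..k. if i = j then c j / real k else 0)"
    unfolding set_LINT_ulam_step[OF ulam_cell_sets[OF j]]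
  proof (intro sum.cong refl)
    fix i assume i: "i \<in> {1..k}"
    show "c i * measure lebI (ulam_cell k j \<inter> ulam_cell k i) = (if i = j then c j / real k else 0)"
    proof (cases "i = j")
      case True
      then show ?thesis
        using measure_ulam_cell[OF j] by simp
    next
      case False
      then have "ulam_cell k j \<inter> ulam_cell k i = {}"
        using ulam_cell_unique[OF i j] by blast
      with False show ?thesis by simp
    qed
  qed
  also have "\<dots> = c j / real k"
    using j by simp
  finally have eq: "(LINT x:ulam_cell k j|lebI. f x) = c j / real k" .
  show "defect (ulam_cell k j) f = 0"
    using eq c(3)[OF j] k by (simp add: defect_def)
  show "(LINT x:ulam_cell k j|lebI. f x) \<le> ulam_bound / real k"
    unfolding eq using c(2)[OF j] by (rule divide_right_mono) simp
qed

lemma set_LINT_eq_sum_cells: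
  fixes f :: "real \<Rightarrow> real"
  assumes k: "1 \<le> k" and f: "integrable lebI f" and A: "A \<in> sets lebI"
  shows "(LINT x:A|lebI. f x) = (\<Sum>j=1..k. LINT x:A \<inter> ulam_cell k j|lebI. f x)"
    and "(LINT x:vim A|lebI. f x) = (\<Sum>j=1..k. LINT x:vim (A \<inter> ulam_cell k j)|lebI. f x)"
proof -
  have A01: "A \<subseteq> {0..1}"
    using A by (simp add: sets_restrict_space_iff)
  have sets: "A \<inter> ulam_cell k j \<in> sets lebI" "vim (A \<inter> ulam_cell k j) \<in> sets lebI" if "j \<in> {1..k}" for j
    using sets.Int[OF A ulam_cell_sets[OF that]] by (auto simp: vim_sets simp del: vimage_Int)
  have disj: "disjoint_family_on (\<lambda>j. A \<inter> ulam_cell k j) {1..k}"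
    "disjoint_family_on (\<lambda>j. vim (A \<inter> ulam_cell k j)) {1..k}"
    using disjoint_family_ulam_cell[of k] unfolding disjoint_family_on_def by blast+
  have eq: "(\<Union>j\<in>{1..k}. A \<inter> ulam_cell k j) = A" "(\<Union>j\<in>{1..k}. vim (A \<inter> ulam_cell k j)) = vim A"
    using A01 UN_ulam_cell[OF k] by blast+
  have "(LINT x:(\<Union>j\<in>{1..k}. A \<inter> ulam_cell k j)|lebI. f x) = (\<Sum>j=1..k. LINT x:A \<inter> ulam_cell k j|lebI. f x)"
    by (rule set_integral_finite_Union) (use disj sets f in \<open>auto intro: set_integrable_lebI\<close>)
  then show "(LINT x:A|lebI. f x) = (\<Sum>j=1..k. LINT x:A \<inter> ulam_cell k j|lebI. f x)"
    unfolding eq .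
  have "(LINT x:(\<Union>j\<in>{1..k}. vim (A \<inter> ulam_cell k j))|lebI. f x)
      = (\<Sum>j=1..k. LINT x:vim (A \<inter> ulam_cell k j)|lebI. f x)"
    by (rule set_integral_finite_Union) (use disj sets f in \<open>auto intro: set_integrable_lebI simp del: vimage_Int\<close>)
  then show "(LINT x:vim A|lebI. f x) = (\<Sum>j=1..k. LINT x:vim (A \<inter> ulam_cell k j)|lebI. f x)"
    unfolding eq .
qed

text \<open>Only the cell containing \<open>t\<close> contributes to the defect of a half-line.\<close>

lemma abs_defect_greaterThan_le:
  assumes k: "1 \<le> k" and f: "normalized_ulam_fixed_point T k f"
  shows "\<bar>defect ({t<..} \<inter> {0..1}) f\<bar> \<le> 2 * ulam_bound / real k"
proof -
  let ?A = "{t<..} \<inter> {0..1}"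
  have fint: "integrable lebI f" and f0: "AE x in lebI. 0 \<le> f x"
    using ulam_fixed_point_bounded[OF k f] by (auto simp: L1_def)
  have A: "?A \<in> sets lebI"
    by (simp add: sets_restrict_space_iff)
  have bound0: "0 \<le> ulam_bound / real k"
    using defect_ulam_cell(2)[OF k f, of 1] set_LINT_nonneg_lebI[OF f0, of "ulam_cell k 1"] k by simp
  have cell: "\<bar>defect (?A \<inter> ulam_cell k j) f\<bar> \<le> (if t \<in> ulam_cell k j then 2 * ulam_bound / real k else 0)"
    if j: "j \<in> {1..k}" for j
  proof (cases "t \<in> ulam_cell k j")
    case True
    \<comment> \<open>Both integrals lie between 0 and \<open>ulam_bound / k\<close>; for the
      preimage this uses that the full cell has zero defect.\<close>
    note cell_sets = ulam_cell_sets[OF j]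
    have int_sets: "?A \<inter> ulam_cell k j \<in> sets lebI"
      using A cell_sets by (rule sets.Int)
    have "(LINT x:?A \<inter> ulam_cell k j|lebI. f x) \<le> (LINT x:ulam_cell k j|lebI. f x)"
      by (rule set_LINT_mono_set_lebI[OF fint f0 int_sets cell_sets]) auto
    moreover have "(LINT x:vim (?A \<inter> ulam_cell k j)|lebI. f x) \<le> (LINT x:vim (ulam_cell k j)|lebI. f x)"
      by (rule set_LINT_mono_set_lebI[OF fint f0 vim_sets[OF int_sets] vim_sets[OF cell_sets]]) auto
    ultimately show ?thesis
      using True defect_ulam_cell[OF k f j] bound0
        set_LINT_nonneg_lebI[OF f0, of "?A \<inter> ulam_cell k j"] set_LINT_nonneg_lebI[OF f0, of "vim (?A \<inter> ulam_cell k j)"]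
      unfolding defect_def by (simp only: if_True)
  next
    case False
    \<comment> \<open>A cell is an interval, so a cell that misses \<open>t\<close> lies entirely on
      one side of it.\<close>
    have "\<not> (y \<le> t \<and> t \<le> z)" if "y \<in> ulam_cell k j" "z \<in> ulam_cell k j" for y z
      using that False by (auto simp: ulam_cell_iff split: if_splits)
    then have "(\<forall>z\<in>ulam_cell k j. t < z) \<or> (\<forall>y\<in>ulam_cell k j. y \<le> t)"
      by (meson linear not_le)
    then have "?A \<inter> ulam_cell k j = ulam_cell k j \<or> ?A \<inter> ulam_cell k j = {}"
    proof
      assume "\<forall>z\<in>ulam_cell k j. t < z"
      then have "ulam_cell k j \<subseteq> ?A"
        using ulam_cell_subset[OF j] by blast
      then show ?thesis by blast
    next
      assume "\<forall>y\<in>ulam_cell k j. y \<le> t"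
      then have "?A \<inter> ulam_cell k j = {}"
        by (auto simp: not_less)
      then show ?thesis ..
    qed
    moreover have "defect {} f = 0"
      by (simp add: defect_def)
    ultimately have "defect (?A \<inter> ulam_cell k j) f = 0"
      using defect_ulam_cell(1)[OF k f j] by metis
    with False show ?thesis by simp
  qed
  have "\<bar>defect ?A f\<bar> = \<bar>\<Sum>j=1..k. defect (?A \<inter> ulam_cell k j) f\<bar>"
    unfolding defect_def sum_subtractf set_LINT_eq_sum_cells[OF k fint A] ..
  also have "\<dots> \<le> (\<Sum>j=1..k. if t \<in> ulam_cell k j then 2 * ulam_bound / real k else 0)"
    by (rule order_trans[OF sum_abs sum_mono[OF cell]])
  also have "\<dots> \<le> 2 * ulam_bound / real k"
  proof (cases "\<exists>i\<in>{1..k}. t \<in> ulam_cell k i")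
    case True
    then obtain i where i: "i \<in> {1..k}" "t \<in> ulam_cell k i"
      by blast
    have "(\<Sum>j=1..k. if t \<in> ulam_cell k j then 2 * ulam_bound / real k else 0)
        = (\<Sum>j=1..k. if j = i then 2 * ulam_bound / real k else 0)"
      by (intro sum.cong refl) (metis i ulam_cell_unique)
    then show ?thesis
      using i by simp
  next
    case False
    then show ?thesis
      using bound0 by simp
  qed
  finally show ?thesis .
qed

text \<open>The measure with density \<open>g\<close> and its image under \<open>T\<close> are
  finite Borel measures that agree on half-lines, hence on all Borel sets.\<close>

lemma defect_eq_0:
  assumes g: "g \<in> L1" "AE x in lebI. 0 \<le> g x"
    and half: "\<And>t. defect ({t<..} \<inter> {0..1}) g = 0" and A: "A \<in> sets lebI"
  shows "defect A g = 0"
proof -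
  have gint: "integrable lebI g"
    using g by (simp add: L1_def)
  define D where "D = density lebI (\<lambda>x. ennreal (g x))"
  have D_eq: "emeasure D A = ennreal (LINT x:A|lebI. g x)" if "A \<in> sets lebI" for A
    unfolding D_def by (rule emeasure_density_set_LINT[OF gint g(2) that])
  have id: "(\<lambda>x. x) \<in> D \<rightarrow>\<^sub>M borel" and TD: "T \<in> D \<rightarrow>\<^sub>M borel"
  proof -
    have lb: "(\<lambda>x. x) \<in> lebI \<rightarrow>\<^sub>M borel"
      by (intro measurable_restrict_space1 measurable_completion) simp
    then show "(\<lambda>x. x) \<in> D \<rightarrow>\<^sub>M borel"
      by (simp add: D_def)
    show "T \<in> D \<rightarrow>\<^sub>M borel"
      using measurable_compose[OF measurable_T lb] by (simp add: D_def)
  qed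
  have int_sets: "B \<inter> {0..1} \<in> sets lebI" if "B \<in> sets borel" for B :: "real set"
    using that by (simp add: sets_restrict_space_iff)
  have 1: "emeasure (distr D borel (\<lambda>x. x)) B = ennreal (LINT x:B \<inter> {0..1}|lebI. g x)" if "B \<in> sets borel" for B
    using emeasure_distr[OF id that] D_eq[OF int_sets[OF that]] by (simp add: D_def)
  have 2: "emeasure (distr D borel T) B = ennreal (LINT x:vim (B \<inter> {0..1})|lebI. g x)" if "B \<in> sets borel" for B
  proof -
    have "vim (B \<inter> {0..1}) = vim B"
      using maps_to by auto
    then show ?thesis
      using emeasure_distr[OF TD that] D_eq[OF vim_sets[OF int_sets[OF that]]] by (simp add: D_def)
  qed
  have "distr D borel (\<lambda>x. x) = distr D borel T"
  proof (rule measure_eqI_lessThan)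
    show "emeasure (distr D borel (\<lambda>x. x)) {t<..} = emeasure (distr D borel T) {t<..}" for t
      using half[of t] by (simp add: 1 2 defect_def)
    show "emeasure (distr D borel (\<lambda>x. x)) {t<..} < \<infinity>" for t
      by (simp add: 1)
  qed simp_all
  then have borel: "(LINT x:B \<inter> {0..1}|lebI. g x) = (LINT x:vim (B \<inter> {0..1})|lebI. g x)" if "B \<in> sets borel" for B
    using 1[OF that] 2[OF that] set_LINT_nonneg_lebI[OF g(2)] by simp
  \<comment> \<open>A Lebesgue set differs from a Borel set by a null set, which changes neither
    integral; for the preimage this is nonsingularity.\<close>
  have "A \<in> sets lebesgue" "A \<subseteq> {0..1}"
    using A by (auto simp: sets_restrict_space_iff)
  then obtain B N N' where AB: "A = B \<union> N" "N \<subseteq> N'" "N' \<in> null_sets lborel" "B \<in> sets lborel"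
    by (auto elim: sets_completionE)
  have N: "negligible N"
    using AB by (meson negligible_iff_null_sets negligible_subset null_sets_completionI)
  have B: "B \<in> sets borel" "B \<inter> {0..1} = B" "B \<in> sets lebI"
    using AB \<open>A \<subseteq> {0..1}\<close> by (auto simp: sets_restrict_space_iff)
  have "(LINT x:A|lebI. g x) = (LINT x:B|lebI. g x)"
    unfolding set_lebesgue_integral_def
  proof (rule integral_cong_AE)
    show "AE x in lebI. indicator A x *\<^sub>R g x = indicator B x *\<^sub>R g x"
      using AE_lebI_not_negligible[OF N] by eventually_elim (auto simp: AB indicator_def)
  qed (use integrable_mult_indicator[OF _ gint] A B in auto)
  moreover have "(LINT x:vim A|lebI. g x) = (LINT x:vim B|lebI. g x)"
    unfolding set_lebesgue_integral_def
  proof (rule integral_cong_AE)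
    show "AE x in lebI. indicator (vim A) x *\<^sub>R g x = indicator (vim B) x *\<^sub>R g x"
      using AE_T_not_in[OF N] by eventually_elim (auto simp: AB indicator_def)
  qed (use integrable_mult_indicator[OF vim_sets gint] A B in auto)
  ultimately show ?thesis
    using borel[OF B(1)] by (simp add: defect_def B(2))
qed

lemma ulam_fixed_points_weak_limit:
  assumes f: "\<And>k. k \<ge> 1 \<Longrightarrow> normalized_ulam_fixed_point T k (f k)"
  shows "weakly_precompact (f ` {1..})"
    and "weak_limit_point f g \<Longrightarrow> fixed_point_L1 (frobenius_perron T) g"
proof -
  have bounded: "f k \<in> L1 \<and> (AE x in lebI. 0 \<le> f k x \<and> f k x \<le> ulam_bound)" if "k \<ge> 1" for k
    using ulam_fixed_point_bounded[OF that f[OF that]] by blast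
  show "weakly_precompact (f ` {1..})"
    using bounded by (intro weakly_precompact_if_bounded) auto
  assume g: "weak_limit_point f g"
  \<comment> \<open>The weakly closed order interval passes nonnegativity on to the limit point, so
    that \<open>g\<close> can serve as the density of a measure.\<close>
  have "g \<in> {g \<in> L1. AE x in lebI. 0 \<le> g x \<and> g x \<le> ulam_bound}"
    using bounded by (intro weak_limit_point_in_closed[OF g closedin_weak_L1_order_interval, of 1]) blast
  then have gL1: "g \<in> L1" and g0: "AE x in lebI. 0 \<le> g x"
    by auto
  have half: "defect ({t<..} \<inter> {0..1}) g = 0" for t
  proof (rule weak_limit_point_L1_dual[OF g defect_in_L1_dual])
    show "{t<..} \<inter> {0..1} \<in> sets lebI"
      by (simp add: sets_restrict_space_iff)
    show "(\<lambda>k. defect ({t<..} \<inter> {0..1}) (f k)) \<longlonglongrightarrow> 0"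
    proof (rule Lim_null_comparison)
      show "\<forall>\<^sub>F k in sequentially. norm (defect ({t<..} \<inter> {0..1}) (f k)) \<le> 2 * ulam_bound / real k"
        using eventually_ge_at_top[of 1] by eventually_elim (simp add: abs_defect_greaterThan_le f)
      show "(\<lambda>k. 2 * ulam_bound / real k) \<longlonglongrightarrow> 0"
        by (rule lim_const_over_n)
    qed
  qed
  show "fixed_point_L1 (frobenius_perron T) g"
    using defect_eq_0[OF gL1 g0 half] by (intro fixed_point_frobenius_perron[OF gL1]) (simp add: defect_def)
qed

end

section \<open>The approximating maps as piecewise expanding maps\<close>

lemma convex_on_eq:
  assumes f: "convex_on S f" and eq: "\<And>x. x \<in> S \<Longrightarrow> g x = f x"
  shows "convex_on S g"
  unfolding convex_on_def
proof (intro conjI ballI allI impI)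
  show "convex S"
    using f by (rule convex_on_imp_convex)
  fix x y and u v :: real
  assume xy: "x \<in> S" "y \<in> S" "0 \<le> u" "0 \<le> v" "u + v = 1"
  then have "u *\<^sub>R x + v *\<^sub>R y \<in> S"
    using convexD[OF \<open>convex S\<close>] by blast
  then show "g (u *\<^sub>R x + v *\<^sub>R y) \<le> u * g x + v * g y"
    using f xy eq unfolding convex_on_def by simp
qed

text \<open>Branch 0 is the linear piece on \<open>{0..<a n}\<close>; for \<open>j\<close> from 1 to
  \<open>n\<close>, branch \<open>j\<close> is \<tau> on \<open>{a j..<a (j - 1)}\<close>, with the
  right derivative at \<open>a j\<close> as its slope bound.\<close>

lemma piecewise_expanding_approx_map:
  assumes a: "piecewise_convex_map a \<tau>" and n: "1 \<le> n"
  obtains l r d where "piecewise_expanding_map (approx_map a \<tau> n) {0..n} l r d"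
proof -
  let ?T = "approx_map a \<tau> n"
  have a0: "a 0 = 1" and dec: "\<And>j. a (Suc j) < a j" and lim: "a \<longlonglongrightarrow> 0"
    and maps: "\<tau> \<in> {0..1} \<rightarrow> {0..1}"
    and cvx: "\<And>j. 1 \<le> j \<Longrightarrow> convex_on {a j..<a (j - 1)} \<tau>"
    and zero: "\<And>j. 1 \<le> j \<Longrightarrow> \<tau> (a j) = 0"
    using a by (auto simp: piecewise_convex_map_def)
  obtain D where D: "\<And>j. 1 \<le> j \<Longrightarrow> (\<tau> has_real_derivative D j) (at_right (a j))" "\<And>j. 1 \<le> j \<Longrightarrow> 0 < D j"
    using a unfolding piecewise_convex_map_def by blast
  have anti: "a j < a i" if "i < j" for i j
    using lift_Suc_mono_less[of "\<lambda>j. - a j", OF _ that] dec by simp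
  have anti_le: "a j \<le> a i" if "i \<le> j" for i j
    using anti[of i j] that by (cases "i = j") auto
  have pos: "0 < a j" for j
  proof -
    have "0 \<le> a (Suc j)"
      by (rule LIMSEQ_le_const2[OF lim]) (use anti_le in blast)
    then show ?thesis
      using dec[of j] by simp
  qed
  have an: "0 < a n" "a n < 1"
    using pos anti[of 0 n] n a0 by auto
  define l where "l j = (if j = 0 then 0 else a j)" for j
  define r where "r j = (if j = 0 then a n else a (j - 1))" for j
  define d where "d j = (if j = 0 then 1 / a n else D j)" for j
  have T_eq: "?T x = \<tau> x" if "a n \<le> x" for x
    using that by (simp add: approx_map_def)
  have "piecewise_expanding_map ?T {0..n} l r d"
  proof (rule piecewise_expanding_map.intro)
    show "finite {0..n}" by simp
    show "l 0 = 0" "r 0 < 1" "d 0 = 1 / r 0" "0 \<in> {0..n}"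
      using an by (simp_all add: l_def r_def d_def)
    show "?T x = x / r 0" if "x \<in> {0..<r 0}" for x
      using that by (simp add: r_def approx_map_def)
    show "0 < l j" if "j \<noteq> 0" for j
      using that pos by (simp add: l_def)
    show "l j < r j" if "j \<in> {0..n}" for j
      using that an anti[of "j - 1" j] by (auto simp: l_def r_def)
    show "?T \<in> {0..1} \<rightarrow> {0..1}"
      using maps an by (auto simp: approx_map_def Pi_iff divide_le_eq)
    show "(\<Union>j\<in>{0..n}. {l j..<r j}) = {0..<1}"
    proof
      show "(\<Union>j\<in>{0..n}. {l j..<r j}) \<subseteq> {0..<1}"
      proof (intro UN_least subsetI)
        fix j x assume "j \<in> {0..n}" "x \<in> {l j..<r j}"
        then show "x \<in> {0..<1}"
          using an pos[of j] anti_le[of 0 "j - 1"] a0 by (auto simp: l_def r_def split: if_splits)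
      qed
      show "{0..<1} \<subseteq> (\<Union>j\<in>{0..n}. {l j..<r j})"
      proof
        fix x :: real assume x: "x \<in> {0..<1}"
        show "x \<in> (\<Union>j\<in>{0..n}. {l j..<r j})"
        proof (cases "x < a n")
          case True
          then show ?thesis
            using x by (intro UN_I[of 0]) (auto simp: l_def r_def)
        next
          case False
          \<comment> \<open>As \<open>a\<close> decreases, the least index with
            \<open>a j \<le> x\<close> is that of the branch containing \<open>x\<close>; it is not
            0 because \<open>x < 1 = a 0\<close>.\<close>
          define j where "j = (LEAST j. a j \<le> x)"
          have j: "a j \<le> x" "j \<le> n"
            using LeastI[of "\<lambda>j. a j \<le> x" n] Least_le[of "\<lambda>j. a j \<le> x" n] False by (auto simp: j_def)
          have "j \<noteq> 0"
            using j(1) x a0 by (intro notI) simp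
          then have "x < a (j - 1)"
            using not_less_Least[of "j - 1" "\<lambda>j. a j \<le> x"] by (simp add: j_def not_le)
          with j \<open>j \<noteq> 0\<close> show ?thesis
            by (intro UN_I[of j]) (auto simp: l_def r_def)
        qed
      qed
    qed
    show "disjoint_family_on (\<lambda>j. {l j..<r j}) {0..n}"
    proof -
      have "{l i..<r i} \<inter> {l j..<r j} = {}" if "i \<in> {0..n}" "j \<in> {0..n}" "i < j" for i j
      proof (cases "i = 0")
        case True
        then show ?thesis
          using that anti_le[of j n] by (auto simp: l_def r_def)
      next
        case False
        have "i \<le> j - 1"
          using that(3) by simp
        from anti_le[OF this] False show ?thesis
          using that by (auto simp: l_def r_def)
      qed
      then show ?thesis
        unfolding disjoint_family_on_def by (metis Int_commute linorder_neqE_nat)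
    qed
    show "convex_branch ?T (l j) (r j) (d j)" if j: "j \<in> {0..n}" for j
    proof (cases "j = 0")
      case True
      have lin: "?T x = x / a n" if "x \<in> {0..<a n}" for x
        using that by (simp add: approx_map_def)
      show ?thesis
      proof
        have "convex_on {0..<a n} (\<lambda>x. x / a n)"
          by (simp add: convex_on_def add_divide_distrib)
        then have "convex_on {0..<a n} ?T"
          using lin by (rule convex_on_eq)
        then show "convex_on {l j..<r j} ?T"
          using True by (simp add: l_def r_def)
      qed (use True an in \<open>auto simp: l_def r_def d_def approx_map_def diff_divide_distrib\<close>)
    next
      case False
      then have j1: "1 \<le> j" by simp
      have ge: "a n \<le> x" if "x \<in> {a j..<a (j - 1)}" for x
        using that anti_le[of j n] j by auto
      show ?thesis
      proof
        have "convex_on {a j..<a (j - 1)} ?T"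
          using cvx[OF j1] T_eq[OF ge] by (rule convex_on_eq)
        then show "convex_on {l j..<r j} ?T"
          using False by (simp add: l_def r_def)
        show "?T (l j) = 0"
          using False zero[OF j1] T_eq anti_le[of j n] j by (simp add: l_def)
        show "0 < d j"
          using False D(2)[OF j1] by (simp add: d_def)
        show "d j * (y - x) \<le> ?T y - ?T x" if "l j \<le> x" "x < y" "y < r j" for x y
          using convex_on_secant_ge_right_deriv[OF cvx[OF j1] D(1)[OF j1], of x y] that False ge T_eq
          by (simp add: l_def r_def d_def)
      qed
    qed
  qed
  with that show ?thesis .
qed

theorem theorem4:
  fixes a :: "nat \<Rightarrow> real" and \<tau> :: "real \<Rightarrow> real" and n :: nat
    and f :: "nat \<Rightarrow> real \<Rightarrow> real"
  assumes "piecewise_convex_map a \<tau>"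
    and "n \<ge> 1"
    and "\<And>k. k \<ge> 1 \<Longrightarrow> normalized_ulam_fixed_point (approx_map a \<tau> n) k (f k)"
  shows "weakly_precompact (f ` {1..}) \<and>
    (\<forall>g. weak_limit_point f g \<longrightarrow>
      fixed_point_L1 (frobenius_perron (approx_map a \<tau> n)) g)"
proof -
  obtain l r d where "piecewise_expanding_map (approx_map a \<tau> n) {0..n} l r d"
    using assms(1,2) by (rule piecewise_expanding_approx_map)
  then show ?thesis
    using piecewise_expanding_map.ulam_fixed_points_weak_limit assms(3) by blast
qed

end
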